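(* Let $q\in\mathbb{N}$ be fixed, and suppose that $\langle N\rangle\to\infty$, $\langle M\rangle\to\infty$ and $\kappa:=\langle M\rangle^{q+1}/\langle N\rangle\to0$. Define $$N_\lambda^*:=\frac{\sqrt{\langle M\rangle}}{\sqrt{q+1}}\left(\frac{N_\lambda-\langle N\rangle}{\langle N\rangle}\right),\qquad M_\lambda^*:=\frac{M_\lambda-\langle M\rangle}{\sqrt{\langle M\rangle}}.$$ Then, under $\mathsf{P}_{\boldsymbol z}$, both $N^*_\lambda$ and $M^*_\lambda$ are asymptotically standard normal, i.e. $N_\lambda^*\to\mathcal{N}(0,1)$ and $M_\lambda^*\to\mathcal{N}(0,1)$ in distribution. Moreover, the joint limiting distribution of $(N_\lambda^*,M_\lambda^* )$ is bivariate normal with zero mean and covariance matrix $$\boldsymbol{K}_q=\begin{pmatrix}1&\frac{1}{\sqrt{q+1}}\\ \frac{1}{\sqrt{q+1}}&1\end{pmatrix}.$$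
   Context: $\mathbb{N}=\{1,2,\dots\}$, $\mathbb{N}^q=\{j^q: j\in\mathbb{N}\}$. $\check{\Lambda}^q$ is the set of all strict integer partitions into $q$-th powers, i.e. finite (possibly empty) sequences $\lambda_1>\lambda_2>\cdots$ of distinct elements of $\mathbb{N}^q$. For $\lambda\in\check\Lambda^q$, the weight $N_\lambda$ is the sum of its parts and the length $M_\lambda$ is the number of its parts. For $\boldsymbol z=(z_1,z_2)$ with $0<z_1<1$, $z_2>0$, the Boltzmann distribution on $\check\Lambda^q$ is $\mathsf{P}_{\boldsymbol z}(\lambda)=z_1^{N_\lambda}z_2^{M_\lambda}/F(\boldsymbol z)$, where $F(\boldsymbol z)=\sum_{\lambda\in\check\Lambda^q}z_1^{N_\lambda}z_2^{M_\lambda}$; $\mathsf{E}_{\boldsymbol z}$ is the corresponding expectation. Given real hyper-parameters $\langle N\rangle,\langle M\rangle>0$, the parameter $\boldsymbol z$ is calibrated as the root of $\mathsf{E}_{\boldsymbol z}(N_\lambda)=\langle N\rangle$, $\mathsf{E}_{\boldsymbol z}(M_\lambda)=\langle M\rangle$, so $\boldsymbol z$ and $\mathsf{P}_{\boldsymbol z}$ depend on the hyper-parameters; it satisfies $z_1=\exp\bigl(-\frac{\langle M\rangle}{q\langle N\rangle}(1+O(\kappa^{1/q}))\bigr)$, $z_2=\frac{\kappa^{1/q}}{q^{1/q}\Gamma(1+1/q)}(1+O(\kappa^{1/q}))$. *)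

theory Defs
  imports "HOL-Probability.Probability"
begin

definition strict_power_partitions :: "nat \<Rightarrow> nat list set" where
  "strict_power_partitions q =
     {xs. sorted_wrt (>) xs \<and> set xs \<subseteq> {j ^ q | j. j \<ge> 1}}"

definition weight :: "nat list \<Rightarrow> real" where
  "weight xs = real (sum_list xs)"

definition len :: "nat list \<Rightarrow> real" where
  "len xs = real (length xs)"

definition boltzmann_term :: "real \<times> real \<Rightarrow> nat list \<Rightarrow> real" where
  "boltzmann_term z xs = fst z ^ sum_list xs * snd z ^ length xs"

definition partition_function :: "nat \<Rightarrow> real \<times> real \<Rightarrow> real" where
  "partition_function q z = (\<Sum>\<^sub>\<infinity>xs\<in>strict_power_partitions q. boltzmann_term z xs)"

definition boltzmann :: "nat \<Rightarrow> real \<times> real \<Rightarrow> nat list measure" where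
  "boltzmann q z = point_measure (strict_power_partitions q)
     (\<lambda>xs. ennreal (boltzmann_term z xs / partition_function q z))"

text \<open>All polynomial moments are finite for \<open>0 < z\<^sub>1 < 1\<close> and \<open>0 < z\<^sub>2\<close>, so the convention that
  the Bochner integral of a non-integrable function is \<open>0\<close> plays no role here.\<close>

definition calibrated :: "nat \<Rightarrow> real \<Rightarrow> real \<Rightarrow> real \<times> real \<Rightarrow> bool" where
  "calibrated q N M z \<longleftrightarrow>
     0 < fst z \<and> fst z < 1 \<and> 0 < snd z \<and>
     (\<integral>xs. weight xs \<partial>boltzmann q z) = N \<and>
     (\<integral>xs. len xs \<partial>boltzmann q z) = M"

definition norm_weight :: "nat \<Rightarrow> real \<Rightarrow> real \<Rightarrow> nat list \<Rightarrow> real" where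
  "norm_weight q N M xs = sqrt M / sqrt (real q + 1) * ((weight xs - N) / N)"

definition norm_len :: "real \<Rightarrow> nat list \<Rightarrow> real" where
  "norm_len M xs = (len xs - M) / sqrt M"

text \<open>The library's \<open>weak_conv_m\<close> covers the real line only.\<close>

definition weak_conv_vec ::
  "(nat \<Rightarrow> 'a::topological_space measure) \<Rightarrow> 'a measure \<Rightarrow> bool" where
  "weak_conv_vec \<mu> \<nu> \<longleftrightarrow>
     (\<forall>f :: 'a \<Rightarrow> real. continuous_on UNIV f \<and> bounded (range f) \<longrightarrow>
        (\<lambda>n. \<integral>x. f x \<partial>\<mu> n) \<longlonglongrightarrow> (\<integral>x. f x \<partial>\<nu>))"

text \<open>The density is meaningful for a symmetric positive definite covariance matrix \<open>K\<close>.\<close>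

definition multivariate_normal :: "real ^ 'n \<Rightarrow> real ^ 'n ^ 'n \<Rightarrow> (real ^ 'n) measure" where
  "multivariate_normal m K = density lborel
     (\<lambda>x. ennreal (exp (- ((x - m) \<bullet> (matrix_inv K *v (x - m))) / 2)
                     / sqrt ((2 * pi) ^ CARD('n) * det K)))"

definition limit_cov :: "nat \<Rightarrow> real ^ 2 ^ 2" where
  "limit_cov q = vector [vector [1, 1 / sqrt (real q + 1)],
                         vector [1 / sqrt (real q + 1), 1]]"

end

theory Submission
  imports Defs
begin

text \<open>Under the Boltzmann law the events that \<open>j\<^sup>q\<close> is a part are independent with probabilities
  \<open>p\<^sub>j = z\<^sub>2 z\<^sub>1\<^bsup>j^q\<^esup> / (1 + z\<^sub>2 z\<^sub>1\<^bsup>j^q\<^esup>)\<close>, so the joint characteristic function of \<open>(N\<^sub>\<lambda>, M\<^sub>\<lambda>)\<close> is the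
  infinite product of the factors \<open>1 + p\<^sub>j (exp (i a\<^sub>j) - 1)\<close> with \<open>a\<^sub>j = s j\<^sup>q + t\<close>. Since all \<open>p\<^sub>j \<le> z\<^sub>2\<close>, the
  centred product differs from \<open>exp (- \<Sum> p\<^sub>j a\<^sub>j\<^sup>2 / 2)\<close> by at most \<open>z\<^sub>2 \<Sum> p\<^sub>j a\<^sub>j\<^sup>2 + \<Sum> p\<^sub>j \<bar>a\<^sub>j\<bar>\<^sup>3 / 6\<close>.
  Put \<open>z\<^sub>1 = exp (- h\<^sup>q)\<close>. The hypothesis \<open>\<kappa> \<rightarrow> 0\<close> forces \<open>z\<^sub>2 \<rightarrow> 0\<close>, because \<open>z\<^sub>2 \<ge> \<epsilon>\<close> would give
  \<open>\<langle>N\<rangle> = O(\<langle>M\<rangle>\<^bsup>q+1\<^esup>)\<close>; then \<open>\<langle>M\<rangle> \<rightarrow> \<infinity>\<close> forces \<open>h \<rightarrow> 0\<close>. Hence the power sums \<open>S\<^sub>k = \<Sum> j\<^bsup>kq\<^esup> p\<^sub>j\<close> are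
  asymptotic to \<open>z\<^sub>2 c\<^sub>k / h\<^bsup>kq+1\<^esup>\<close> as Riemann sums, where \<open>c\<^sub>k = \<integral> x\<^bsup>kq\<^esup> exp (- x\<^sup>q) dx\<close> satisfies
  \<open>q c\<^bsub>k+1\<^esub> = (k q + 1) c\<^sub>k\<close>. With \<open>S\<^sub>0 = \<langle>M\<rangle>\<close> and \<open>S\<^sub>1 = \<langle>N\<rangle>\<close> from the calibration, this gives
  \<open>\<langle>M\<rangle> S\<^sub>2 / \<langle>N\<rangle>\<^sup>2 \<rightarrow> q + 1\<close> and the cubic term vanishes in the limit.\<close>

section \<open>Levy continuity in several dimensions\<close>

text \<open>Complex linear combinations of the characters of the space. Integrating one against a
  probability measure gives a linear combination of values of its characteristic function.\<close>

inductive trig_poly :: "('a::real_inner \<Rightarrow> complex) \<Rightarrow> bool" where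
  monomial: "trig_poly (\<lambda>x. c * cis (u \<bullet> x))"
| add: "trig_poly f \<Longrightarrow> trig_poly g \<Longrightarrow> trig_poly (\<lambda>x. f x + g x)"

lemma trig_poly_const: "trig_poly (\<lambda>x. c)"
  using trig_poly.monomial[of c 0] by simp

text \<open>Frequencies add under multiplication, \<open>cis a * cis b = cis (a + b)\<close>; a
  double induction extends this bilinearly. Closure under products is what lets polynomials in sines
  and cosines count as trigonometric polynomials.\<close>

lemma trig_poly_mult:
  assumes "trig_poly f" "trig_poly g"
  shows "trig_poly (\<lambda>x. f x * g x)"
  using assms(1)
proof induction
  case (monomial c u)
  from assms(2) show ?case
  proof induction
    case (monomial d v)
    have "(\<lambda>x. c * cis (u \<bullet> x) * (d * cis (v \<bullet> x))) = (\<lambda>x. (c * d) * cis ((u + v) \<bullet> x))"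
      by (simp add: inner_add_left mult_ac flip: cis_mult)
    then show ?case
      using trig_poly.monomial[of "c * d" "u + v"] by simp
  next
    case (add f g)
    then show ?case
      using trig_poly.add by (fastforce simp: distrib_left)
  qed
next
  case (add f1 f2)
  then show ?case
    using trig_poly.add by (fastforce simp: distrib_right)
qed

lemma trig_poly_sum:
  assumes "\<And>i. i \<in> I \<Longrightarrow> trig_poly (f i)"
  shows "trig_poly (\<lambda>x. \<Sum>i\<in>I. f i x)"
  using assms
  by (induction I rule: infinite_finite_induct) (auto intro: trig_poly_const trig_poly.add)

lemma trig_poly_cos: "trig_poly (\<lambda>x. complex_of_real (cos (u \<bullet> x)))"
proof -
  have "(\<lambda>x. complex_of_real (cos (u \<bullet> x))) = (\<lambda>x. 1/2 * cis (u \<bullet> x) + 1/2 * cis ((-u) \<bullet> x))"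
    by (auto simp: complex_eq_iff)
  then show ?thesis
    by (simp only: trig_poly.intros)
qed

lemma trig_poly_sin: "trig_poly (\<lambda>x. complex_of_real (sin (u \<bullet> x)))"
proof -
  have "(\<lambda>x. complex_of_real (sin (u \<bullet> x))) =
      (\<lambda>x. (-\<i>/2) * cis (u \<bullet> x) + (\<i>/2) * cis ((-u) \<bullet> x))"
    by (auto simp: complex_eq_iff)
  then show ?thesis
    by (simp only: trig_poly.intros)
qed

section \<open>Approximation by trigonometric polynomials on a box\<close>

text \<open>Each coordinate is wrapped around the unit circle with period \<open>2 * pi / c\<close>.
  A polynomial on the image therefore pulls back to a periodic function.\<close>

definition torus_map :: "real \<Rightarrow> real ^ 'n \<Rightarrow> complex ^ 'n" where
  "torus_map c x = (\<chi> i. cis (c * x $ i))"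

lemma continuous_on_torus_map [continuous_intros]: "continuous_on S (torus_map c)"
  unfolding torus_map_def by (intro continuous_intros)

text \<open>All coordinates have modulus 1. The resulting ball contains the whole image and serves
  as the compact set for Stone--Weierstrass.\<close>

lemma norm_torus_map_le: "norm (torus_map c x :: complex ^ 'n) \<le> real CARD('n)"
proof -
  have "norm (torus_map c x) \<le> (\<Sum>i\<in>UNIV. norm (torus_map c x $ i))"
    unfolding norm_vec_def by (rule L2_set_le_sum) simp
  then show ?thesis
    by (simp add: torus_map_def)
qed

text \<open>A real-linear functional is evaluated on the real basis \<open>axis i 1\<close>,
  \<open>axis i \<i>\<close>, in which the coordinates of the torus point are cosines and sines of
  \<open>c * x $ i\<close>. Closure under sums and products handles all other polynomials.\<close>

lemma trig_poly_polynomial_torus_map: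
  assumes "real_polynomial_function p"
  shows "trig_poly (\<lambda>x. complex_of_real (p (torus_map c x :: complex ^ 'n)))"
  using assms
proof induction
  case (linear f)
  interpret bounded_linear f by fact
  have inner: "(c *\<^sub>R axis i 1) \<bullet> x = c * x $ i" for x :: "real ^ 'n" and i
    by (simp add: inner_axis')
  have "torus_map c x = (\<Sum>i\<in>UNIV. cos ((c *\<^sub>R axis i 1) \<bullet> x) *\<^sub>R axis i 1
      + sin ((c *\<^sub>R axis i 1) \<bullet> x) *\<^sub>R axis i \<i>)" for x :: "real ^ 'n"
    unfolding inner
    by (auto simp: vec_eq_iff torus_map_def axis_def complex_eq_iff if_distrib cong: if_cong)
  then have "complex_of_real (f (torus_map c x)) =
      (\<Sum>i\<in>UNIV. complex_of_real (cos ((c *\<^sub>R axis i 1) \<bullet> x)) * f (axis i 1)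
        + complex_of_real (sin ((c *\<^sub>R axis i 1) \<bullet> x)) * f (axis i \<i>))" for x :: "real ^ 'n"
    by (simp add: sum add scaleR)
  moreover have "trig_poly (\<lambda>x. \<Sum>i\<in>UNIV. complex_of_real (cos ((c *\<^sub>R axis i 1) \<bullet> x)) * f (axis i 1)
        + complex_of_real (sin ((c *\<^sub>R axis i 1) \<bullet> x)) * f (axis i \<i> :: complex ^ 'n))"
    by (intro trig_poly_sum trig_poly.add trig_poly_mult trig_poly_cos trig_poly_sin trig_poly_const)
  ultimately show ?case
    by (simp only:)
qed (auto intro: trig_poly_const trig_poly.add trig_poly_mult)

text \<open>The imaginary parts already separate points, because sine is injective on
  \<open>[-pi/2, pi/2]\<close>.\<close>

lemma inj_on_torus_map:
  assumes "c > 0"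
  shows "inj_on (torus_map c) {x :: real ^ 'n. \<forall>i. \<bar>c * x $ i\<bar> \<le> pi / 2}"
proof (rule inj_onI)
  fix x y :: "real ^ 'n"
  assume x: "x \<in> {x. \<forall>i. \<bar>c * x $ i\<bar> \<le> pi / 2}" and y: "y \<in> {x. \<forall>i. \<bar>c * x $ i\<bar> \<le> pi / 2}"
    and eq: "torus_map c x = torus_map c y"
  have "x $ i = y $ i" for i
  proof -
    have "\<bar>c * x $ i\<bar> \<le> pi / 2" "\<bar>c * y $ i\<bar> \<le> pi / 2"
      using x y by simp_all
    moreover have "sin (c * x $ i) = sin (c * y $ i)"
      using arg_cong[OF eq, of "\<lambda>v. Im (v $ i)"] unfolding torus_map_def by simp
    ultimately have "c * x $ i = c * y $ i"
      by - (rule sin_inj_pi; linarith)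
    then show ?thesis
      using assms by simp
  qed
  then show "x = y"
    unfolding vec_eq_iff ..
qed

text \<open>A bounded continuous function is pulled back from a box to the torus, extended there by
  Tietze's theorem and approximated by Stone--Weierstrass; periodicity keeps the bound globally.\<close>

lemma trig_poly_approx:
  fixes f :: "real ^ 'n \<Rightarrow> real"
  assumes "continuous_on UNIV f" "\<And>x. \<bar>f x\<bar> \<le> B" "e > 0" "T > 0"
  obtains p :: "real ^ 'n \<Rightarrow> real"
  where "trig_poly (\<lambda>x. complex_of_real (p x))" "continuous_on UNIV p" "\<And>x. \<bar>p x\<bar> \<le> B + e"
    "\<And>x. (\<And>i. \<bar>x $ i\<bar> \<le> T) \<Longrightarrow> \<bar>f x - p x\<bar> \<le> e"
proof -
  \<comment> \<open>This scale maps the box of half-width \<open>T\<close> exactly to the range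
    \<open>\<bar>c * x $ i\<bar> \<le> pi / 2\<close> on which the torus map is injective.\<close>
  define c where "c = pi / (2 * T)"
  have c: "c > 0" using assms by (simp add: c_def)
  define K where "K = cbox (\<chi> i. - T) ((\<chi> i. T) :: real ^ 'n)"
  have K: "x \<in> K \<longleftrightarrow> (\<forall>i. \<bar>x $ i\<bar> \<le> T)" for x
    by (auto simp: K_def mem_box_cart abs_le_iff minus_le_iff)
  have "\<bar>c * t\<bar> \<le> pi / 2 \<longleftrightarrow> \<bar>t\<bar> \<le> T" for t :: real
  proof -
    have cT: "c * T = pi / 2" using assms(4) by (simp add: c_def)
    show ?thesis using c unfolding cT[symmetric] by (simp add: abs_mult)
  qed
  then have inj: "inj_on (torus_map c) K"
    using inj_on_torus_map[OF c, where 'n='n] by (simp add: K inj_on_def)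
  have "compact K" by (simp add: K_def)
  then obtain g where g: "homeomorphism K (torus_map c ` K) (torus_map c) g"
    using homeomorphism_compact[OF \<open>compact K\<close> _ refl inj] continuous_on_torus_map by blast
  have "0 \<le> B" using assms(2)[of 0] by linarith
  have cK: "compact (torus_map c ` K)"
    using \<open>compact K\<close> compact_continuous_image continuous_on_torus_map by blast
  obtain h where h: "continuous_on UNIV h" "\<And>x. x \<in> torus_map c ` K \<Longrightarrow> h x = f (g x)"
    "\<And>x. norm (h x) \<le> B"
  proof (rule Tietze[of "torus_map c ` K" "\<lambda>x. f (g x)" UNIV B])
    show "continuous_on (torus_map c ` K) (\<lambda>x. f (g x))"
      by (rule continuous_on_compose2[OF assms(1) homeomorphism_cont2[OF g]]) simp
    show "closedin (top_of_set UNIV) (torus_map c ` K)"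
      using cK compact_imp_closed by auto
  qed (use \<open>0 \<le> B\<close> assms(2) in simp_all)
  obtain p where p: "real_polynomial_function p"
    "\<And>x. x \<in> cball 0 (real CARD('n)) \<Longrightarrow> \<bar>h x - p x\<bar> < e"
    by (rule Stone_Weierstrass_real_polynomial_function[OF compact_cball
          continuous_on_subset[OF h(1) subset_UNIV] assms(3)]) blast
  have approx: "\<bar>h (torus_map c x) - p (torus_map c x)\<bar> < e" for x
    using p(2)[of "torus_map c x"] norm_torus_map_le[of c x] by simp
  show thesis
  proof
    show "trig_poly (\<lambda>x. complex_of_real (p (torus_map c x)))"
      by (rule trig_poly_polynomial_torus_map) fact
    show "continuous_on UNIV (\<lambda>x. p (torus_map c x))"
      using p(1) by (intro continuous_on_compose2[OF _ continuous_on_torus_map subset_UNIV]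
            continuous_on_polymonial_function) (simp add: real_polynomial_function_eq)
    show "\<bar>p (torus_map c x)\<bar> \<le> B + e" for x
      using approx[of x] h(3)[of "torus_map c x"] by auto
    show "\<bar>f x - p (torus_map c x)\<bar> \<le> e" if "\<And>i. \<bar>x $ i\<bar> \<le> T" for x
    proof -
      have "x \<in> K" using that by (simp add: K)
      then have "h (torus_map c x) = f x"
        using h(2)[of "torus_map c x"] homeomorphism_apply1[OF g] by simp
      then show ?thesis using approx[of x] by auto
    qed
  qed
qed

section \<open>From characteristic functions to integrals of continuous functions\<close>

lemma trig_poly_integral_tendsto:
  fixes \<mu> :: "nat \<Rightarrow> 'a::euclidean_space measure" and \<nu> :: "'a measure"
  assumes "\<And>n. prob_space (\<mu> n)" "\<And>n. sets (\<mu> n) = sets borel"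
    and "prob_space \<nu>" "sets \<nu> = sets borel"
    and char: "\<And>u. (\<lambda>n. \<integral>x. cis (u \<bullet> x) \<partial>\<mu> n) \<longlonglongrightarrow> (\<integral>x. cis (u \<bullet> x) \<partial>\<nu>)"
    and "trig_poly p"
  shows "(\<lambda>n. \<integral>x. p x \<partial>\<mu> n) \<longlonglongrightarrow> (\<integral>x. p x \<partial>\<nu>)"
proof -
  have int: "integrable M (\<lambda>x. cis (u \<bullet> x))" if "prob_space M" "sets M = sets borel"
    for M and u :: 'a
  proof -
    interpret prob_space M by fact
    have [measurable]: "(\<lambda>x. cis (u \<bullet> x)) \<in> borel_measurable M"
      unfolding measurable_cong_sets[OF that(2) refl]
      by (intro borel_measurable_continuous_onI continuous_intros)
    show ?thesis
      by (rule integrable_const_bound[of _ 1]) auto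
  qed
  \<comment> \<open>Integrability under every Borel probability measure is carried along in the
    induction, since additivity of the integral needs it for each \<open>\<mu> n\<close> and for
    \<open>\<nu>\<close>.\<close>
  have "(\<forall>M. prob_space M \<longrightarrow> sets M = sets borel \<longrightarrow> integrable M p) \<and>
      (\<lambda>n. \<integral>x. p x \<partial>\<mu> n) \<longlonglongrightarrow> (\<integral>x. p x \<partial>\<nu>)"
    using assms(6)
  proof induction
    case (monomial c u)
    then show ?case
      using int by (auto intro!: tendsto_mult_left char)
  next
    case (add f g)
    then show ?case
      using assms(1-4) by (auto intro!: tendsto_add)
  qed
  then show ?thesis by blast
qed

text \<open>A continuous stand-in for the indicator of \<open>\<bar>x\<bar> > T\<close>: it is 0 up
  to \<open>T\<close> and 1 from \<open>T + 1\<close> on, so its integrals pass to the weak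
  limit.\<close>

definition ramp :: "real \<Rightarrow> real \<Rightarrow> real" where
  "ramp T x = min 1 (max 0 (\<bar>x\<bar> - T))"

lemma continuous_on_ramp [continuous_intros]:
  "continuous_on S f \<Longrightarrow> continuous_on S (\<lambda>x. ramp T (f x))"
  unfolding ramp_def by (intro continuous_intros)

lemma ramp_bounds: "0 \<le> ramp T x" "ramp T x \<le> 1"
  by (auto simp: ramp_def)

lemma integrable_bounded_continuous:
  fixes f :: "'a::euclidean_space \<Rightarrow> real"
  assumes "prob_space M" "sets M = sets borel" "continuous_on UNIV f" "\<And>x. \<bar>f x\<bar> \<le> B"
  shows "integrable M f"
proof -
  interpret prob_space M by fact
  have [measurable]: "f \<in> borel_measurable M"
    unfolding measurable_cong_sets[OF assms(2) refl]
    by (intro borel_measurable_continuous_onI assms)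
  show ?thesis
    by (rule integrable_const_bound[of _ B]) (use assms in auto)
qed

lemma marginal_real_distribution:
  fixes M :: "'a::euclidean_space measure"
  assumes "prob_space M" "sets M = sets borel"
  shows "real_distribution (distr M borel (\<lambda>x. u \<bullet> x))"
proof -
  interpret prob_space M by fact
  have [measurable]: "(\<lambda>x. u \<bullet> x) \<in> borel_measurable M"
    unfolding measurable_cong_sets[OF assms(2) refl]
    by (intro borel_measurable_continuous_onI continuous_intros)
  show ?thesis by simp
qed

lemma marginal_char:
  fixes M :: "'a::euclidean_space measure"
  assumes "sets M = sets borel"
  shows "char (distr M borel (\<lambda>x. u \<bullet> x)) t = (\<integral>x. cis ((t *\<^sub>R u) \<bullet> x) \<partial>M)"
proof -
  have [measurable]: "(\<lambda>x. u \<bullet> x) \<in> borel_measurable M"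
    unfolding measurable_cong_sets[OF assms refl]
    by (intro borel_measurable_continuous_onI continuous_intros)
  show ?thesis
    unfolding char_def by (subst integral_distr) (auto simp: cis_conv_exp)
qed

text \<open>On a large box the test function is replaced by a trigonometric polynomial, whose
  integrals converge by hypothesis. The mass outside the box is controlled by the coordinate
  marginals, to which the one-dimensional continuity theorem applies.\<close>

theorem levy_continuity_vec:
  fixes \<mu> :: "nat \<Rightarrow> (real ^ 'n) measure" and \<nu> :: "(real ^ 'n) measure"
  assumes \<mu>: "\<And>n. prob_space (\<mu> n)" "\<And>n. sets (\<mu> n) = sets borel"
    and \<nu>: "prob_space \<nu>" "sets \<nu> = sets borel"
    and char: "\<And>u. (\<lambda>n. \<integral>x. cis (u \<bullet> x) \<partial>\<mu> n) \<longlonglongrightarrow> (\<integral>x. cis (u \<bullet> x) \<partial>\<nu>)"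
  shows "weak_conv_vec \<mu> \<nu>"
  unfolding weak_conv_vec_def
proof (intro allI impI)
  fix f :: "real ^ 'n \<Rightarrow> real"
  assume f: "continuous_on UNIV f \<and> bounded (range f)"
  then obtain B where B: "\<And>x. \<bar>f x\<bar> \<le> B"
    unfolding bounded_iff by auto
  have "B \<ge> 0" using B[of 0] by linarith
  interpret \<mu>: prob_space "\<mu> n" for n by fact
  interpret \<nu>: prob_space \<nu> by fact
  have meas: "g \<in> borel_measurable M" if "sets M = sets borel" "continuous_on UNIV g"
    for M and g :: "real ^ 'n \<Rightarrow> real"
    unfolding measurable_cong_sets[OF that(1) refl] by (intro borel_measurable_continuous_onI that)
  have ramp_cont: "continuous_on UNIV (\<lambda>x :: real ^ 'n. ramp T (x $ i))" for T i
    by (intro continuous_intros)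
  \<comment> \<open>Convergence of these tail integrals supplies the tightness of the sequence; the
    characteristic function of a coordinate marginal is the given one along a coordinate
    axis.\<close>
  have ramp_lim: "(\<lambda>n. \<integral>x. ramp T (x $ i) \<partial>\<mu> n) \<longlonglongrightarrow> (\<integral>x. ramp T (x $ i) \<partial>\<nu>)" for T i
  proof -
    let ?d = "\<lambda>M. distr M borel (\<lambda>x. axis i (1::real) \<bullet> x)"
    have eq: "(\<integral>y. ramp T y \<partial>?d M) = (\<integral>x. ramp T (x $ i) \<partial>M)" if "sets M = sets borel" for M
    proof (subst integral_distr)
      show "(\<lambda>x. axis i (1::real) \<bullet> x) \<in> M \<rightarrow>\<^sub>M borel"
        by (intro meas that continuous_intros)
      show "ramp T \<in> borel_measurable borel"
        unfolding ramp_def by measurable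
    qed (simp add: inner_axis')
    have "weak_conv_m (\<lambda>n. ?d (\<mu> n)) (?d \<nu>)"
      by (intro levy_continuity marginal_real_distribution \<mu> \<nu>)
        (auto simp: marginal_char \<mu> \<nu> simp del: inner_scaleR_left intro!: char)
    then have "(\<lambda>n. \<integral>y. ramp T y \<partial>?d (\<mu> n)) \<longlonglongrightarrow> (\<integral>y. ramp T y \<partial>?d \<nu>)"
      by (intro weak_conv_imp_integral_bdd_continuous_conv[where B=1] marginal_real_distribution \<mu> \<nu>)
        (auto simp: ramp_bounds continuous_on_eq_continuous_at[symmetric] intro!: continuous_on_ramp continuous_on_interior[of UNIV])
    then show ?thesis
      by (simp only: eq \<mu> \<nu>)
  qed
  have ramp_small: "(\<lambda>k. \<Sum>i\<in>UNIV. \<integral>x. ramp (real k) (x $ i) \<partial>\<nu>) \<longlonglongrightarrow> (\<Sum>i\<in>(UNIV::'n set). 0)"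
  proof (intro tendsto_sum)
    fix i :: 'n
    have "(\<lambda>k. \<integral>x. ramp (real k) (x $ i) \<partial>\<nu>) \<longlonglongrightarrow> (\<integral>x. 0 \<partial>\<nu>)"
    proof (rule integral_dominated_convergence[where w="\<lambda>_. 1"])
      show "AE x in \<nu>. (\<lambda>k. ramp (real k) (x $ i)) \<longlonglongrightarrow> 0"
      proof (rule AE_I2, rule tendsto_eventually)
        fix x :: "real ^ 'n"
        show "\<forall>\<^sub>F k in sequentially. ramp (real k) (x $ i) = 0"
          using eventually_ge_at_top[of "nat \<lceil>\<bar>x $ i\<bar>\<rceil>"]
          by eventually_elim (auto simp: ramp_def)
      qed
      show "(\<lambda>x. ramp (real k) (x $ i)) \<in> borel_measurable \<nu>" for k
        by (intro meas \<nu> ramp_cont)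
    qed (auto simp: ramp_def)
    then show "(\<lambda>k. \<integral>x. ramp (real k) (x $ i) \<partial>\<nu>) \<longlonglongrightarrow> 0" by simp
  qed
  show "(\<lambda>n. \<integral>x. f x \<partial>\<mu> n) \<longlonglongrightarrow> (\<integral>x. f x \<partial>\<nu>)"
  proof (rule LIMSEQ_I)
    fix r :: real assume r: "r > 0"
    \<comment> \<open>Five errors of size \<open>r / 5\<close> add up to \<open>r\<close>:
      approximation and tail under \<open>\<mu> n\<close>, the same two under \<open>\<nu>\<close>,
      and the difference of the integrals of \<open>p\<close>. The cap 1 on \<open>e\<close> bounds
      \<open>2 * B + e\<close> by \<open>2 * B + 1\<close>.\<close>
    define e where "e = min 1 (r / 5)"
    define e' where "e' = r / (5 * (2 * B + 1))"
    have e: "e > 0" "e \<le> 1" "e \<le> r / 5" "e' > 0"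
      using r \<open>B \<ge> 0\<close> by (auto simp: e_def e'_def)
    obtain k where k: "norm ((\<Sum>i\<in>UNIV. \<integral>x. ramp (real k) (x $ i) \<partial>\<nu>) - 0) < e'"
      using LIMSEQ_D[OF ramp_small[simplified] e(4)] by blast
    define R where "R x = (\<Sum>i\<in>UNIV. ramp (real k) (x $ i))" for x :: "real ^ 'n"
    have R_nn: "0 \<le> R x" for x by (auto simp: R_def ramp_bounds intro!: sum_nonneg)
    have R_int: "integrable M R \<and> (\<integral>x. R x \<partial>M) = (\<Sum>i\<in>UNIV. \<integral>x. ramp (real k) (x $ i) \<partial>M)"
      if M: "prob_space M" "sets M = sets borel" for M
    proof -
      have "integrable M (\<lambda>x. ramp (real k) (x $ i))" for i
        by (rule integrable_bounded_continuous[OF M ramp_cont, where B=1]) (simp add: ramp_bounds)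
      then show ?thesis
        unfolding R_def by (simp add: Bochner_Integration.integral_sum)
    qed
    have R_lim: "(\<lambda>n. \<integral>x. R x \<partial>\<mu> n) \<longlonglongrightarrow> (\<integral>x. R x \<partial>\<nu>)"
      using R_int \<mu> \<nu> by (simp add: tendsto_sum ramp_lim)
    have R_small: "(\<integral>x. R x \<partial>\<nu>) < e'"
      using k R_int[OF \<nu>] by simp
    obtain p where p: "trig_poly (\<lambda>x. complex_of_real (p x))" "continuous_on UNIV p"
      "\<And>x. \<bar>p x\<bar> \<le> B + e" "\<And>x. (\<And>i. \<bar>x $ i\<bar> \<le> real k + 1) \<Longrightarrow> \<bar>f x - p x\<bar> \<le> e"
      using trig_poly_approx[of f B e "real k + 1"] f B e(1) by auto
    have p_lim: "(\<lambda>n. \<integral>x. p x \<partial>\<mu> n) \<longlonglongrightarrow> (\<integral>x. p x \<partial>\<nu>)"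
      using trig_poly_integral_tendsto[OF \<mu> \<nu> char p(1)] by (simp add: tendsto_of_real_iff)
    \<comment> \<open>Outside the box some coordinate exceeds \<open>k + 1\<close>, so its ramp
      equals 1 and \<open>R x \<ge> 1\<close> pays for the crude bound
      \<open>2 * B + e\<close>.\<close>
    have pt: "\<bar>f x - p x\<bar> \<le> e + (2 * B + 1) * R x" for x
    proof (cases "\<forall>i. \<bar>x $ i\<bar> \<le> real k + 1")
      case True
      then show ?thesis
        using p(4)[of x] R_nn[of x] \<open>B \<ge> 0\<close> by (simp add: add_increasing2)
    next
      case False
      then obtain i where "\<bar>x $ i\<bar> > real k + 1" by (auto simp: not_le)
      then have "1 = ramp (real k) (x $ i)" by (simp add: ramp_def)
      also have "\<dots> \<le> R x" unfolding R_def by (rule member_le_sum) (auto simp: ramp_bounds)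
      finally have "2 * B + 1 \<le> (2 * B + 1) * R x"
        using \<open>B \<ge> 0\<close> by (simp add: mult_le_cancel_left1)
      moreover have "\<bar>f x - p x\<bar> \<le> B + (B + e)"
        using B[of x] p(3)[of x] by linarith
      ultimately show ?thesis using e by linarith
    qed
    have fp: "\<bar>(\<integral>x. f x \<partial>M) - (\<integral>x. p x \<partial>M)\<bar> \<le> e + (2 * B + 1) * (\<integral>x. R x \<partial>M)"
      if M: "prob_space M" "sets M = sets borel" for M
    proof -
      interpret prob_space M by fact
      have i: "integrable M f" "integrable M p" "integrable M R"
        using integrable_bounded_continuous[OF M] f B p R_int[OF M] by blast+
      have "\<bar>(\<integral>x. f x \<partial>M) - (\<integral>x. p x \<partial>M)\<bar> \<le> (\<integral>x. \<bar>f x - p x\<bar> \<partial>M)"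
        using i integral_abs_bound[of M "\<lambda>x. f x - p x"] by (simp add: Bochner_Integration.integral_diff)
      also have "\<dots> \<le> (\<integral>x. e + (2 * B + 1) * R x \<partial>M)"
        using i pt by (intro integral_mono) auto
      also have "\<dots> = e + (2 * B + 1) * (\<integral>x. R x \<partial>M)"
        using i by (simp add: prob_space)
      finally show ?thesis .
    qed
    have Be: "(2 * B + 1) * e' = r / 5" using \<open>B \<ge> 0\<close> by (simp add: e'_def field_simps)
    have "\<forall>\<^sub>F n in sequentially. (\<integral>x. R x \<partial>\<mu> n) < e'"
      using R_lim R_small by (rule order_tendstoD)
    moreover have "\<forall>\<^sub>F n in sequentially. dist (\<integral>x. p x \<partial>\<mu> n) (\<integral>x. p x \<partial>\<nu>) < r / 5"
      using r by (intro tendstoD[OF p_lim]) simp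
    ultimately have "\<forall>\<^sub>F n in sequentially. norm ((\<integral>x. f x \<partial>\<mu> n) - (\<integral>x. f x \<partial>\<nu>)) < r"
    proof eventually_elim
      case (elim n)
      have "(2 * B + 1) * (\<integral>x. R x \<partial>\<mu> n) < r / 5" "(2 * B + 1) * (\<integral>x. R x \<partial>\<nu>) < r / 5"
        unfolding Be[symmetric] using elim R_small \<open>B \<ge> 0\<close> by (auto intro!: mult_strict_left_mono)
      then show ?case
        using fp[OF \<mu>, of n] fp[OF \<nu>] elim e(3) unfolding dist_real_def real_norm_def by linarith
    qed
    then show "\<exists>no. \<forall>n\<ge>no. norm ((\<integral>x. f x \<partial>\<mu> n) - (\<integral>x. f x \<partial>\<nu>)) < r"
      by (simp add: eventually_sequentially)
  qed
qed

section \<open>The bivariate normal law\<close>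

lemma borel_measurable_cis [measurable]: "cis \<in> borel_measurable borel"
  by (rule borel_measurable_continuous_onI[OF continuous_on_cis[OF continuous_on_id]])

lemma borel_measurable_vector2 [measurable (raw)]:
  assumes "f \<in> borel_measurable M" "g \<in> borel_measurable M"
  shows "(\<lambda>x. vector [f x, g x] :: real ^ 2) \<in> borel_measurable M"
proof (subst borel_measurable_euclidean_space, rule ballI)
  fix b :: "real ^ 2" assume "b \<in> Basis"
  then obtain i where b: "b = axis i 1"
    unfolding Basis_vec_def by auto
  show "(\<lambda>x. vector [f x, g x] \<bullet> b) \<in> borel_measurable M"
    using exhaust_2[of i] assms by (auto simp: b inner_axis)
qed

text \<open>Lebesgue measure is determined by its values on open boxes, and the preimage of a box is
  a product of two intervals. This opens the vector type to iterated integration.\<close>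

lemma lborel_vec2:
  "(lborel :: (real ^ 2) measure) = distr (lborel \<Otimes>\<^sub>M lborel) borel (\<lambda>p. vector [fst p, snd p])"
proof (rule lborel_eqI)
  fix l u :: "real ^ 2"
  assume le: "\<And>b. b \<in> Basis \<Longrightarrow> l \<bullet> b \<le> u \<bullet> b"
  have B: "Basis = {axis 1 (1::real), axis 2 1 :: real ^ 2}"
    unfolding Basis_vec_def UNIV_2 by auto
  have le': "l $ 1 \<le> u $ 1" "l $ 2 \<le> u $ 2"
    using le[of "axis 1 1"] le[of "axis 2 1"] by (simp_all add: B inner_axis)
  have "(\<lambda>p. vector [fst p, snd p]) -` box l u = {l $ 1<..<u $ 1} \<times> {l $ 2<..<u $ 2}"
    by (auto simp: mem_box_cart forall_2)
  then have "emeasure (distr (lborel \<Otimes>\<^sub>M lborel) borel (\<lambda>p. vector [fst p, snd p])) (box l u) =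
      emeasure (lborel \<Otimes>\<^sub>M lborel) ({l $ 1<..<u $ 1} \<times> {l $ 2<..<u $ 2})"
    by (subst emeasure_distr) (auto simp: space_pair_measure)
  also have "\<dots> = ennreal (u $ 1 - l $ 1) * ennreal (u $ 2 - l $ 2)"
    using le' by (subst lborel.emeasure_pair_measure_Times) auto
  also have "\<dots> = (\<Prod>b\<in>Basis. (u - l) \<bullet> b)"
    using le' by (simp add: B inner_axis axis_eq_axis ennreal_mult')
  finally show "emeasure (distr (lborel \<Otimes>\<^sub>M lborel) borel (\<lambda>p. vector [fst p, snd p])) (box l u) =
      (\<Prod>b\<in>Basis. (u - l) \<bullet> b)" .
qed simp

lemma nn_integral_lborel_vec2:
  assumes [measurable]: "g \<in> borel_measurable (borel :: (real ^ 2) measure)"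
  shows "(\<integral>\<^sup>+x. g x \<partial>lborel) = (\<integral>\<^sup>+y. \<integral>\<^sup>+x. g (vector [x, y]) \<partial>lborel \<partial>lborel)"
proof -
  have "(\<integral>\<^sup>+x. g x \<partial>lborel) = (\<integral>\<^sup>+p. g (vector [fst p, snd p]) \<partial>(lborel \<Otimes>\<^sub>M lborel))"
    by (subst lborel_vec2, subst nn_integral_distr) auto
  also have "\<dots> = (\<integral>\<^sup>+y. \<integral>\<^sup>+x. g (vector [x, y]) \<partial>lborel \<partial>lborel)"
    by (subst lborel_pair.nn_integral_snd[symmetric]) auto
  finally show ?thesis .
qed

section \<open>Normal laws with unit variances and correlation \<open>\<rho>\<close>\<close>

definition corr_matrix :: "real \<Rightarrow> real ^ 2 ^ 2" where
  "corr_matrix \<rho> = vector [vector [1, \<rho>], vector [\<rho>, 1]]"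

text \<open>A right inverse of a square matrix is also a left inverse. This provides the existence
  that the choice operator inside \<open>matrix_inv\<close> requires.\<close>

lemma matrix_inv_unique:
  fixes A B :: "real ^ 'n ^ 'n"
  assumes "A ** B = mat 1"
  shows "matrix_inv A = B"
proof -
  have BA: "B ** A = mat 1"
    using assms matrix_left_right_inverse by blast
  then have "\<exists>A'. A ** A' = mat 1 \<and> A' ** A = mat 1"
    using assms by blast
  then have "A ** matrix_inv A = mat 1"
    unfolding matrix_inv_def by (rule someI2_ex) blast
  then have "B ** (A ** matrix_inv A) = B"
    by simp
  then show ?thesis
    by (simp add: matrix_mul_assoc BA)
qed

lemma quadratic_form_corr_matrix_inv:
  assumes "\<rho>\<^sup>2 < 1"
  shows "x \<bullet> (matrix_inv (corr_matrix \<rho>) *v x) =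
    ((x $ 1)\<^sup>2 - 2 * \<rho> * (x $ 1) * (x $ 2) + (x $ 2)\<^sup>2) / (1 - \<rho>\<^sup>2)"
proof -
  let ?B = "vector [vector [1 / (1 - \<rho>\<^sup>2), - \<rho> / (1 - \<rho>\<^sup>2)], vector [- \<rho> / (1 - \<rho>\<^sup>2), 1 / (1 - \<rho>\<^sup>2)]] :: real ^ 2 ^ 2"
  have "1 - \<rho>\<^sup>2 \<noteq> 0" using assms by simp
  then have "corr_matrix \<rho> ** ?B = mat 1"
    by (auto simp: corr_matrix_def vec_eq_iff forall_2 matrix_matrix_mult_def sum_2 mat_def
        divide_simps power2_eq_square)
  then have "matrix_inv (corr_matrix \<rho>) = ?B"
    by (rule matrix_inv_unique)
  then show ?thesis
    by (simp add: inner_vec_def sum_2 matrix_vector_mult_def power2_eq_square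
        add_divide_distrib diff_divide_distrib algebra_simps)
qed

text \<open>For fixed second coordinate \<open>y\<close>, the substitution
  \<open>x = \<rho> * y + \<sigma> * u\<close> completes the square: the quadratic form becomes
  \<open>\<sigma>\<^sup>2 * (u\<^sup>2 + y\<^sup>2)\<close>, and the Jacobian
  \<open>\<sigma>\<close> cancels against the normalisation. What remains is the product of two
  standard normal densities.\<close>

lemma multivariate_normal_corr_matrix:
  assumes "\<rho>\<^sup>2 < 1"
  shows "multivariate_normal 0 (corr_matrix \<rho>) =
    distr (std_normal_distribution \<Otimes>\<^sub>M std_normal_distribution) borel
      (\<lambda>p. vector [\<rho> * snd p + sqrt (1 - \<rho>\<^sup>2) * fst p, snd p])"
    (is "_ = distr ?S borel ?L")
proof (rule measure_eqI)
  interpret S: real_distribution std_normal_distribution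
    by (rule real_dist_normal_dist)
  interpret P: pair_prob_space std_normal_distribution std_normal_distribution ..
  define \<sigma> where "\<sigma> = sqrt (1 - \<rho>\<^sup>2)"
  have \<sigma>: "\<sigma> > 0" "\<sigma>\<^sup>2 = 1 - \<rho>\<^sup>2"
    using assms by (auto simp: \<sigma>_def)
  define d where "d x = exp (- (((x $ 1)\<^sup>2 - 2 * \<rho> * (x $ 1) * (x $ 2) + (x $ 2)\<^sup>2) / \<sigma>\<^sup>2) / 2) / (2 * pi * \<sigma>)"
    for x :: "real ^ 2"
  have dens: "multivariate_normal 0 (corr_matrix \<rho>) = density lborel (\<lambda>x. ennreal (d x))"
  proof -
    have "sqrt ((2 * pi)\<^sup>2 * (1 - \<rho>\<^sup>2)) = 2 * pi * \<sigma>"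
      by (simp add: real_sqrt_mult \<sigma>_def)
    moreover have "det (corr_matrix \<rho>) = 1 - \<rho>\<^sup>2"
      by (simp add: det_2 corr_matrix_def power2_eq_square)
    ultimately show ?thesis
      unfolding multivariate_normal_def d_def
      by (simp add: quadratic_form_corr_matrix_inv[OF assms] \<sigma>(2))
  qed
  have [measurable]: "d \<in> borel_measurable borel"
    unfolding d_def by measurable
  show "sets (multivariate_normal 0 (corr_matrix \<rho>)) = sets (distr ?S borel ?L)"
    by (simp add: dens)
  fix A assume "A \<in> sets (multivariate_normal 0 (corr_matrix \<rho>))"
  then have [measurable]: "A \<in> sets borel" by (simp add: dens)
  have factor: "ennreal \<sigma> * (ennreal (d (vector [\<rho> * y + \<sigma> * u, y])) * i) =
      ennreal (std_normal_density y) * (ennreal (std_normal_density u) * i)" for u y i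
  proof -
    have "((\<rho> * y + \<sigma> * u)\<^sup>2 - 2 * \<rho> * (\<rho> * y + \<sigma> * u) * y + y\<^sup>2) = \<sigma>\<^sup>2 * u\<^sup>2 + (1 - \<rho>\<^sup>2) * y\<^sup>2"
      by (simp add: power2_eq_square algebra_simps)
    also have "\<dots> = \<sigma>\<^sup>2 * (u\<^sup>2 + y\<^sup>2)"
      by (simp add: \<sigma>(2) algebra_simps)
    finally have "d (vector [\<rho> * y + \<sigma> * u, y]) = exp (- (u\<^sup>2 + y\<^sup>2) / 2) / (2 * pi * \<sigma>)"
      using \<sigma>(1) by (simp add: d_def)
    moreover have "std_normal_density y * std_normal_density u = exp (- (u\<^sup>2 + y\<^sup>2) / 2) / (2 * pi)"
    proof -
      have "std_normal_density y * std_normal_density u =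
          (exp (- y\<^sup>2 / 2) * exp (- u\<^sup>2 / 2)) / (sqrt (2 * pi) * sqrt (2 * pi))"
        by (simp add: normal_density_def)
      also have "exp (- y\<^sup>2 / 2) * exp (- u\<^sup>2 / 2) = exp (- (u\<^sup>2 + y\<^sup>2) / 2)"
        by (simp add: exp_add[symmetric] field_simps)
      also have "sqrt (2 * pi) * sqrt (2 * pi) = 2 * pi" by simp
      finally show ?thesis .
    qed
    ultimately have "\<sigma> * d (vector [\<rho> * y + \<sigma> * u, y]) = std_normal_density y * std_normal_density u"
      using \<sigma>(1) by simp
    then show ?thesis
      using \<sigma>(1) by (simp add: mult.assoc[symmetric] flip: ennreal_mult')
  qed
  have "emeasure (multivariate_normal 0 (corr_matrix \<rho>)) A =
      (\<integral>\<^sup>+x. ennreal (d x) * indicator A x \<partial>lborel)"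
    by (simp add: dens emeasure_density)
  also have "\<dots> = (\<integral>\<^sup>+y. \<integral>\<^sup>+x. ennreal (d (vector [x, y])) * indicator A (vector [x, y]) \<partial>lborel \<partial>lborel)"
    by (subst nn_integral_lborel_vec2) auto
  also have "\<dots> = (\<integral>\<^sup>+y. \<integral>\<^sup>+u. ennreal \<sigma> * (ennreal (d (vector [\<rho> * y + \<sigma> * u, y])) *
      indicator A (vector [\<rho> * y + \<sigma> * u, y])) \<partial>lborel \<partial>lborel)"
  proof (rule nn_integral_cong)
    fix y :: real
    show "(\<integral>\<^sup>+x. ennreal (d (vector [x, y])) * indicator A (vector [x, y]) \<partial>lborel) =
        (\<integral>\<^sup>+u. ennreal \<sigma> * (ennreal (d (vector [\<rho> * y + \<sigma> * u, y])) *
      indicator A (vector [\<rho> * y + \<sigma> * u, y])) \<partial>lborel)"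
      using \<sigma>(1) by (subst nn_integral_real_affine[where c=\<sigma> and t="\<rho> * y"]) (simp_all add: nn_integral_cmult)
  qed
  also have "\<dots> = (\<integral>\<^sup>+y. \<integral>\<^sup>+u. indicator A (vector [\<rho> * y + \<sigma> * u, y])
      \<partial>std_normal_distribution \<partial>std_normal_distribution)"
    unfolding factor by (simp add: nn_integral_density nn_integral_cmult)
  also have "\<dots> = (\<integral>\<^sup>+p. indicator A (?L p) \<partial>?S)"
    by (subst P.nn_integral_snd[symmetric]) (auto simp: \<sigma>_def)
  also have "\<dots> = emeasure (distr ?S borel ?L) A"
    by (simp add: nn_integral_distr flip: nn_integral_indicator)
  finally show "emeasure (multivariate_normal 0 (corr_matrix \<rho>)) A = emeasure (distr ?S borel ?L) A" .
qed

text \<open>Under the linear representation by two independent standard normals, the inner product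
  with \<open>w\<close> is a sum of independent centred normals with variances
  \<open>(w $ 1)\<^sup>2 * (1 - \<rho>\<^sup>2)\<close> and
  \<open>(w $ 1 * \<rho> + w $ 2)\<^sup>2\<close>; their sum is the quadratic form.\<close>

lemma
  assumes "\<rho>\<^sup>2 < 1"
  shows prob_space_multivariate_normal: "prob_space (multivariate_normal 0 (corr_matrix \<rho>))"
    and char_multivariate_normal: "(\<integral>x. cis (w \<bullet> x) \<partial>multivariate_normal 0 (corr_matrix \<rho>)) =
      complex_of_real (exp (- ((w $ 1)\<^sup>2 + 2 * \<rho> * (w $ 1) * (w $ 2) + (w $ 2)\<^sup>2) / 2))"
proof -
  interpret S: real_distribution std_normal_distribution
    by (rule real_dist_normal_dist)
  interpret P: pair_prob_space std_normal_distribution std_normal_distribution ..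
  let ?S = "std_normal_distribution \<Otimes>\<^sub>M std_normal_distribution"
  let ?L = "\<lambda>p. vector [\<rho> * snd p + sqrt (1 - \<rho>\<^sup>2) * fst p, snd p] :: real ^ 2"
  show "prob_space (multivariate_normal 0 (corr_matrix \<rho>))"
    unfolding multivariate_normal_corr_matrix[OF assms] by (rule P.prob_space_distr) simp
  have "w \<bullet> ?L p = w $ 1 * sqrt (1 - \<rho>\<^sup>2) * fst p + (w $ 1 * \<rho> + w $ 2) * snd p" for p
    by (simp add: inner_vec_def sum_2 algebra_simps)
  then have *: "cis (w \<bullet> ?L p) = cis (w $ 1 * sqrt (1 - \<rho>\<^sup>2) * fst p) * cis ((w $ 1 * \<rho> + w $ 2) * snd p)" for p
    by (simp add: cis_mult)
  have int: "integrable ?S (\<lambda>p. cis (w $ 1 * sqrt (1 - \<rho>\<^sup>2) * fst p) * cis ((w $ 1 * \<rho> + w $ 2) * snd p))"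
    by (rule P.integrable_const_bound[of _ 1]) (auto simp: norm_mult)
  have "(\<integral>x. cis (w \<bullet> x) \<partial>multivariate_normal 0 (corr_matrix \<rho>)) =
      (\<integral>p. cis (w $ 1 * sqrt (1 - \<rho>\<^sup>2) * fst p) * cis ((w $ 1 * \<rho> + w $ 2) * snd p) \<partial>?S)"
    unfolding multivariate_normal_corr_matrix[OF assms] by (subst integral_distr) (auto simp: *)
  also have "\<dots> = (\<integral>u. \<integral>y. cis (w $ 1 * sqrt (1 - \<rho>\<^sup>2) * u) * cis ((w $ 1 * \<rho> + w $ 2) * y)
      \<partial>std_normal_distribution \<partial>std_normal_distribution)"
    by (subst P.integral_fst'[OF int, symmetric]) simp
  also have "\<dots> = char std_normal_distribution (w $ 1 * sqrt (1 - \<rho>\<^sup>2)) *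
      char std_normal_distribution (w $ 1 * \<rho> + w $ 2)"
    by (simp add: char_def cis_conv_exp)
  also have "\<dots> = complex_of_real (exp (- ((w $ 1)\<^sup>2 * (1 - \<rho>\<^sup>2)) / 2 + - ((w $ 1 * \<rho> + w $ 2)\<^sup>2) / 2))"
    using assms unfolding char_std_normal_distribution exp_add
    by (simp add: power_mult_distrib)
  also have "- ((w $ 1)\<^sup>2 * (1 - \<rho>\<^sup>2)) / 2 + - ((w $ 1 * \<rho> + w $ 2)\<^sup>2) / 2 =
      - ((w $ 1)\<^sup>2 + 2 * \<rho> * (w $ 1) * (w $ 2) + (w $ 2)\<^sup>2) / 2"
    by (simp add: power2_eq_square field_simps)
  finally show "(\<integral>x. cis (w \<bullet> x) \<partial>multivariate_normal 0 (corr_matrix \<rho>)) =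
      complex_of_real (exp (- ((w $ 1)\<^sup>2 + 2 * \<rho> * (w $ 1) * (w $ 2) + (w $ 2)\<^sup>2) / 2))" .
qed

section \<open>The Boltzmann distribution\<close>

text \<open>Expanding the finite product gives the sum over subsets of \<open>{..<n}\<close>.
  Monotone convergence, with the convergent product of \<open>1 + norm (c j)\<close> as limit,
  yields integrability; dominated convergence then yields the limit for \<open>c\<close>
  itself.\<close>

lemma
  fixes c :: "nat \<Rightarrow> 'a :: {real_normed_field, banach, second_countable_topology}"
  assumes "summable (\<lambda>j. norm (c j))"
  shows integrable_prod_finite_subsets: "integrable (count_space {A. finite A}) (\<lambda>A. \<Prod>j\<in>A. c j)"
    and prod_tendsto_integral_finite_subsets:
      "(\<lambda>n. \<Prod>j<n. 1 + c j) \<longlonglongrightarrow> (\<integral>A. (\<Prod>j\<in>A. c j) \<partial>count_space {A. finite A})"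
proof -
  let ?C = "count_space {A :: nat set. finite A}"
  \<comment> \<open>Stated for arbitrary \<open>d\<close> and type, because it is applied both to
    \<open>c\<close> and to the real sequence of its norms.\<close>
  have trunc: "(\<integral>A. indicator (Pow {..<n}) A *\<^sub>R (\<Prod>j\<in>A. d j) \<partial>?C) = (\<Prod>j<n. 1 + d j)"
    "integrable ?C (\<lambda>A. indicator (Pow {..<n}) A *\<^sub>R (\<Prod>j\<in>A. d j))"
    for n and d :: "nat \<Rightarrow> 'b :: {real_normed_field, banach, second_countable_topology}"
  proof -
    have sub: "Pow {..<n} \<subseteq> {A :: nat set. finite A}"
    proof
      fix A :: "nat set" assume "A \<in> Pow {..<n}"
      then show "A \<in> {A. finite A}" using finite_subset[of A "{..<n}"] by simp
    qed
    have fin: "finite {A \<in> {A :: nat set. finite A}. indicator (Pow {..<n}) A *\<^sub>R (\<Prod>j\<in>A. d j) \<noteq> 0}"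
      by (rule finite_subset[of _ "Pow {..<n}"]) (auto simp: indicator_def)
    show "integrable ?C (\<lambda>A. indicator (Pow {..<n}) A *\<^sub>R (\<Prod>j\<in>A. d j))"
    proof (rule integrableI_bounded)
      have "(\<integral>\<^sup>+A. ennreal (norm (indicator (Pow {..<n}) A *\<^sub>R (\<Prod>j\<in>A. d j))) \<partial>?C) =
          (\<Sum>A\<in>Pow {..<n}. ennreal (norm (indicator (Pow {..<n}) A *\<^sub>R (\<Prod>j\<in>A. d j))))"
        using sub by (intro nn_integral_count_space') (auto simp: indicator_def)
      also have "\<dots> < \<infinity>" by simp
      finally show "(\<integral>\<^sup>+A. ennreal (norm (indicator (Pow {..<n}) A *\<^sub>R (\<Prod>j\<in>A. d j))) \<partial>?C) < \<infinity>" .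
    qed simp
    have "(\<integral>A. indicator (Pow {..<n}) A *\<^sub>R (\<Prod>j\<in>A. d j) \<partial>?C) =
        (\<Sum>A\<in>Pow {..<n}. indicator (Pow {..<n}) A *\<^sub>R (\<Prod>j\<in>A. d j))"
      unfolding lebesgue_integral_count_space_finite_support[OF fin]
      using sub by (intro sum.mono_neutral_left) (auto simp: indicator_def)
    also have "\<dots> = (\<Sum>A\<in>Pow {..<n}. (\<Prod>j\<in>A. d j) * (\<Prod>j\<in>{..<n} - A. 1))"
      by (intro sum.cong) auto
    also have "\<dots> = (\<Prod>j<n. d j + 1)"
      by (rule prod_add[symmetric]) simp
    finally show "(\<integral>A. indicator (Pow {..<n}) A *\<^sub>R (\<Prod>j\<in>A. d j) \<partial>?C) = (\<Prod>j<n. 1 + d j)"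
      by (simp add: add.commute)
  qed
  have lim: "(\<lambda>n. indicator (Pow {..<n}) A *\<^sub>R x) \<longlonglongrightarrow> x" if "finite A" for A :: "nat set" and x :: "'b :: real_normed_vector"
  proof (rule tendsto_eventually)
    from that obtain m where "A \<subseteq> {..<m}"
      using finite_nat_iff_bounded by blast
    then have "A \<subseteq> {..<n}" if "n \<ge> m" for n
      using that by fastforce
    then show "\<forall>\<^sub>F n in sequentially. indicator (Pow {..<n}) A *\<^sub>R x = x"
      unfolding eventually_sequentially by (auto simp: indicator_def)
  qed
  have int_norm: "integrable ?C (\<lambda>A. \<Prod>j\<in>A. norm (c j))"
  proof (rule integrable_monotone_convergence)
    let ?f = "\<lambda>n A. indicator (Pow {..<n}) A *\<^sub>R (\<Prod>j\<in>A. norm (c j)) :: real"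
    show "integrable ?C (?f n)" for n by (rule trunc)
    show "AE A in ?C. mono (\<lambda>n. ?f n A)"
    proof (rule AE_I2, rule monoI)
      fix A :: "nat set" and m n :: nat assume "m \<le> n"
      then have "Pow {..<m} \<subseteq> Pow {..<n}" by (intro Pow_mono) simp
      then show "?f m A \<le> ?f n A"
        by (intro scaleR_right_mono prod_nonneg) (auto simp: indicator_def)
    qed
    show "AE A in ?C. (\<lambda>n. ?f n A) \<longlonglongrightarrow> (\<Prod>j\<in>A. norm (c j))"
      by (rule AE_I2, rule lim) simp
    have "(\<lambda>n. \<Prod>j<n. 1 + norm (c j)) \<longlonglongrightarrow> prodinf (\<lambda>j. 1 + norm (c j))"
      using assms
      by (intro LIMSEQ_lessThan_iff_atMost[where f="prod (\<lambda>j. 1 + norm (c j))", THEN iffD2]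
          convergent_prod_LIMSEQ abs_convergent_prod_imp_convergent_prod)
        (simp add: abs_convergent_prod_conv_summable)
    then show "(\<lambda>n. integral\<^sup>L ?C (?f n)) \<longlonglongrightarrow> prodinf (\<lambda>j. 1 + norm (c j))"
      unfolding trunc .
  qed simp
  show "integrable ?C (\<lambda>A. \<Prod>j\<in>A. c j)"
    using int_norm by (rule Bochner_Integration.integrable_bound) (auto simp: prod_norm prod_nonneg)
  have "(\<lambda>n. \<integral>A. indicator (Pow {..<n}) A *\<^sub>R (\<Prod>j\<in>A. c j) \<partial>?C) \<longlonglongrightarrow> (\<integral>A. (\<Prod>j\<in>A. c j) \<partial>?C)"
  proof (rule integral_dominated_convergence[OF _ _ int_norm])
    show "AE A in ?C. (\<lambda>n. indicator (Pow {..<n}) A *\<^sub>R (\<Prod>j\<in>A. c j)) \<longlonglongrightarrow> (\<Prod>j\<in>A. c j)"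
      by (rule AE_I2, rule lim) simp
    show "AE A in ?C. norm (indicator (Pow {..<n}) A *\<^sub>R (\<Prod>j\<in>A. c j)) \<le> (\<Prod>j\<in>A. norm (c j))" for n
      by (rule AE_I2) (auto simp: prod_norm prod_nonneg indicator_def)
  qed simp_all
  then show "(\<lambda>n. \<Prod>j<n. 1 + c j) \<longlonglongrightarrow> (\<integral>A. (\<Prod>j\<in>A. c j) \<partial>?C)"
    unfolding trunc .
qed

section \<open>Strict partitions coded by finite sets of indices\<close>

text \<open>Index \<open>j\<close> stands for the part \<open>(j + 1)\<^sup>q\<close>.\<close>

definition partition_of :: "nat \<Rightarrow> nat set \<Rightarrow> nat list" where
  "partition_of q A = rev (sorted_list_of_set ((\<lambda>j. Suc j ^ q) ` A))"

lemma inj_Suc_power: "q \<ge> 1 \<Longrightarrow> inj_on (\<lambda>j. Suc j ^ q) A"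
  by (auto simp: inj_on_def power_eq_iff_eq_base)

lemma sum_list_partition_of:
  assumes "q \<ge> 1" "finite A"
  shows "sum_list (partition_of q A) = (\<Sum>j\<in>A. Suc j ^ q)"
proof -
  have "sum_list (partition_of q A) = \<Sum> ((\<lambda>j. Suc j ^ q) ` A)"
    using assms(2) sum_list_distinct_conv_sum_set[of "sorted_list_of_set ((\<lambda>j. Suc j ^ q) ` A)" "\<lambda>x. x"]
    by (simp add: partition_of_def)
  also have "\<dots> = (\<Sum>j\<in>A. Suc j ^ q)"
    using inj_Suc_power[OF assms(1)] by (simp add: sum.reindex)
  finally show ?thesis .
qed

lemma length_partition_of:
  assumes "q \<ge> 1"
  shows "length (partition_of q A) = card A"
  using inj_Suc_power[OF assms] by (simp add: partition_of_def card_image)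

text \<open>A strictly decreasing list is determined by its set of elements, and distinct indices
  have distinct powers; the inverse collects the indices whose powers occur in the list.\<close>

lemma bij_betw_partition_of:
  assumes "q \<ge> 1"
  shows "bij_betw (partition_of q) {A. finite A} (strict_power_partitions q)"
proof (rule bij_betw_byWitness[where f'="\<lambda>xs. {j. Suc j ^ q \<in> set xs}"])
  have inj: "Suc i ^ q = Suc j ^ q \<longleftrightarrow> i = j" for i j
    using inj_Suc_power[OF assms, of UNIV] by (auto simp: inj_on_def)
  show "\<forall>A\<in>{A. finite A}. {j. Suc j ^ q \<in> set (partition_of q A)} = A"
    by (auto simp: partition_of_def inj image_iff simp del: power_Suc)
  show "\<forall>xs\<in>strict_power_partitions q. partition_of q {j. Suc j ^ q \<in> set xs} = xs"
  proof
    fix xs assume "xs \<in> strict_power_partitions q"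
    then have s: "sorted_wrt (>) xs" and sub: "set xs \<subseteq> {j ^ q | j. j \<ge> 1}"
      by (auto simp: strict_power_partitions_def)
    have "(\<lambda>j. Suc j ^ q) ` {j. Suc j ^ q \<in> set xs} = set xs"
    proof
      show "set xs \<subseteq> (\<lambda>j. Suc j ^ q) ` {j. Suc j ^ q \<in> set xs}"
      proof
        fix x assume "x \<in> set xs"
        with sub obtain j where "j \<ge> 1" "x = j ^ q" by auto
        then show "x \<in> (\<lambda>j. Suc j ^ q) ` {j. Suc j ^ q \<in> set xs}"
          using \<open>x \<in> set xs\<close> by (intro image_eqI[of _ _ "j - 1"]) auto
      qed
    qed auto
    moreover have "sorted_wrt (<) (rev xs)" using s by (simp add: sorted_wrt_rev)
    then have "sorted_list_of_set (set (rev xs)) = rev xs"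
      by (simp add: strict_sorted_iff sorted_list_of_set.idem_if_sorted_distinct del: set_rev)
    ultimately show "partition_of q {j. Suc j ^ q \<in> set xs} = xs"
      by (simp add: partition_of_def)
  qed
  show "partition_of q ` {A. finite A} \<subseteq> strict_power_partitions q"
  proof
    fix xs assume "xs \<in> partition_of q ` {A. finite A}"
    then obtain A where A: "finite A" "xs = partition_of q A" by auto
    have "\<exists>i. Suc j ^ q = i ^ q \<and> 1 \<le> i" for j
      by (intro exI[of _ "Suc j"]) simp
    then show "xs \<in> strict_power_partitions q"
      using A by (auto simp: strict_power_partitions_def partition_of_def sorted_wrt_rev)
  qed
  show "(\<lambda>xs. {j. Suc j ^ q \<in> set xs}) ` strict_power_partitions q \<subseteq> {A. finite A}"
    using inj by (auto intro!: finite_vimageI[unfolded vimage_def] simp: inj_on_def simp del: power_Suc)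
qed

definition part_weight :: "nat \<Rightarrow> real \<times> real \<Rightarrow> nat \<Rightarrow> real" where
  "part_weight q z j = snd z * fst z ^ (Suc j ^ q)"

definition part_prob :: "nat \<Rightarrow> real \<times> real \<Rightarrow> nat \<Rightarrow> real" where
  "part_prob q z j = part_weight q z j / (1 + part_weight q z j)"

section \<open>Partition function, occupation probabilities and characteristic function\<close>

locale boltzmann_params =
  fixes q :: nat and z :: "real \<times> real"
  assumes q: "q \<ge> 1" and z: "0 < fst z" "fst z < 1" "0 < snd z"
begin

abbreviation "w \<equiv> part_weight q z"
abbreviation "p \<equiv> part_prob q z"
abbreviation "F \<equiv> partition_function q z"
abbreviation "C \<equiv> count_space {A :: nat set. finite A}"

lemma w_pos: "w j > 0"
  using z by (simp add: part_weight_def)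

lemma p_pos: "p j > 0" and p_le_w: "p j \<le> w j" and p_le_1: "p j \<le> 1"
  using w_pos[of j] by (auto simp: part_prob_def field_simps)

lemma w_le: "w j \<le> snd z"
  using z by (simp add: part_weight_def power_le_one mult_left_le)

text \<open>From \<open>(1 - w j) * (1 + w j) \<le> 1\<close> and \<open>w j \<le> snd z\<close>.
  Together with \<open>p j \<le> w j\<close> this makes the occupation probabilities interchangeable
  with the weights as \<open>snd z\<close> tends to 0.\<close>

lemma p_ge: "w j * (1 - snd z) \<le> p j"
proof -
  have "w j * (1 - snd z) \<le> w j * (1 - w j)"
    using w_le[of j] w_pos[of j] by (intro mult_left_mono) auto
  also have "\<dots> = w j * ((1 - w j) * (1 + w j)) / (1 + w j)"
    using w_pos[of j] by (simp add: add_nonneg_eq_0_iff)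
  also have "\<dots> \<le> w j * 1 / (1 + w j)"
    using w_pos[of j] by (intro divide_right_mono mult_left_mono) (auto simp: algebra_simps)
  finally show ?thesis by (simp add: part_prob_def)
qed

lemma summable_w: "summable w"
proof (rule summable_comparison_test')
  show "summable (\<lambda>j. snd z * fst z ^ Suc j)"
    using z by (intro summable_mult) (simp add: summable_geometric)
  show "norm (w j) \<le> snd z * fst z ^ Suc j" for j
  proof -
    have "Suc j ^ 1 \<le> Suc j ^ q"
      using q by (intro power_increasing) auto
    then have "fst z ^ (Suc j ^ q) \<le> fst z ^ Suc j"
      using z by (intro power_decreasing) auto
    then show ?thesis
      using z by (simp add: part_weight_def del: power_Suc)
  qed
qed

lemma boltzmann_term_partition_of:
  "finite A \<Longrightarrow> boltzmann_term z (partition_of q A) = (\<Prod>j\<in>A. w j)"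
  by (simp add: boltzmann_term_def part_weight_def sum_list_partition_of[OF q]
      length_partition_of[OF q] prod.distrib power_sum)

lemma integrable_prod_w: "integrable C (\<lambda>A. \<Prod>j\<in>A. w j)"
  using integrable_prod_finite_subsets[of w] summable_w w_pos by (simp add: abs_of_pos)

text \<open>Absolute summability identifies the unordered sum with an integral over counting
  measure, which is then transported along the bijection with finite index sets.\<close>

lemma partition_function_eq: "F = (\<integral>A. (\<Prod>j\<in>A. w j) \<partial>C)"
proof -
  have cong: "integrable C (\<lambda>A. boltzmann_term z (partition_of q A)) \<longleftrightarrow> integrable C (\<lambda>A. \<Prod>j\<in>A. w j)"
    by (intro Bochner_Integration.integrable_cong) (auto simp: boltzmann_term_partition_of)
  have "integrable (count_space (strict_power_partitions q)) (boltzmann_term z)"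
    using integrable_prod_w unfolding cong[symmetric]
    using integrable_bij_count_space[OF bij_betw_partition_of[OF q], of "boltzmann_term z"] by blast
  then have "F = infsetsum (boltzmann_term z) (strict_power_partitions q)"
    unfolding partition_function_def by (intro infsetsum_infsum[symmetric]) (simp add: abs_summable_on_def)
  also have "\<dots> = (\<integral>A. boltzmann_term z (partition_of q A) \<partial>C)"
    unfolding infsetsum_def by (rule integral_bij_count_space[OF bij_betw_partition_of[OF q], symmetric])
  also have "\<dots> = (\<integral>A. (\<Prod>j\<in>A. w j) \<partial>C)"
    by (intro Bochner_Integration.integral_cong) (auto simp: boltzmann_term_partition_of)
  finally show ?thesis .
qed

lemma prod_tendsto_partition_function: "(\<lambda>n. \<Prod>j<n. 1 + w j) \<longlonglongrightarrow> F"
  unfolding partition_function_eq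
  using prod_tendsto_integral_finite_subsets[of w] summable_w w_pos by (simp add: abs_of_pos)

lemma partition_function_pos: "F > 0"
proof -
  have "1 \<le> F"
  proof (rule LIMSEQ_le_const[OF prod_tendsto_partition_function], intro exI allI impI)
    show "1 \<le> (\<Prod>j<n. 1 + w j)" for n
      by (rule prod_ge_1) (simp add: w_pos less_imp_le)
  qed
  then show ?thesis by simp
qed

lemma boltzmann_density:
  "boltzmann q z = density (count_space (strict_power_partitions q))
    (\<lambda>xs. ennreal (boltzmann_term z xs / F))"
  by (simp add: boltzmann_def point_measure_def)

lemma boltzmann_term_nonneg: "boltzmann_term z xs / F \<ge> 0"
  using z partition_function_pos by (simp add: boltzmann_term_def)

lemma measurable_boltzmann: "f \<in> boltzmann q z \<rightarrow>\<^sub>M M \<longleftrightarrow> f \<in> strict_power_partitions q \<rightarrow> space M"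
  by (simp add: boltzmann_def)

lemma nn_integral_boltzmann:
  "(\<integral>\<^sup>+xs. f xs \<partial>boltzmann q z) = (\<integral>\<^sup>+A. ennreal ((\<Prod>j\<in>A. w j) / F) * f (partition_of q A) \<partial>C)"
proof -
  have "(\<integral>\<^sup>+xs. f xs \<partial>boltzmann q z) =
      (\<integral>\<^sup>+A. ennreal (boltzmann_term z (partition_of q A) / F) * f (partition_of q A) \<partial>C)"
    unfolding boltzmann_density
    by (simp add: nn_integral_density nn_integral_bij_count_space[OF bij_betw_partition_of[OF q], symmetric])
  also have "\<dots> = (\<integral>\<^sup>+A. ennreal ((\<Prod>j\<in>A. w j) / F) * f (partition_of q A) \<partial>C)"
    by (intro nn_integral_cong) (simp add: boltzmann_term_partition_of)
  finally show ?thesis .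
qed

lemma integral_boltzmann:
  fixes f :: "nat list \<Rightarrow> 'a :: {banach, second_countable_topology}"
  shows "(\<integral>xs. f xs \<partial>boltzmann q z) = (\<integral>A. ((\<Prod>j\<in>A. w j) / F) *\<^sub>R f (partition_of q A) \<partial>C)"
proof -
  have "(\<integral>xs. f xs \<partial>boltzmann q z) =
      (\<integral>xs. (boltzmann_term z xs / F) *\<^sub>R f xs \<partial>count_space (strict_power_partitions q))"
    unfolding boltzmann_density by (subst integral_density) (auto simp: boltzmann_term_nonneg)
  also have "\<dots> = (\<integral>A. (boltzmann_term z (partition_of q A) / F) *\<^sub>R f (partition_of q A) \<partial>C)"
    by (rule integral_bij_count_space[OF bij_betw_partition_of[OF q], symmetric])
  also have "\<dots> = (\<integral>A. ((\<Prod>j\<in>A. w j) / F) *\<^sub>R f (partition_of q A) \<partial>C)"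
    by (intro Bochner_Integration.integral_cong) (simp_all add: boltzmann_term_partition_of)
  finally show ?thesis .
qed

lemma prob_space_boltzmann: "prob_space (boltzmann q z)"
proof (rule prob_spaceI)
  have "emeasure (boltzmann q z) (space (boltzmann q z)) = (\<integral>\<^sup>+xs. 1 \<partial>boltzmann q z)"
    by simp
  also have "\<dots> = (\<integral>\<^sup>+A. ennreal ((\<Prod>j\<in>A. w j) / F) \<partial>C)"
    unfolding nn_integral_boltzmann by simp
  also have "\<dots> = ennreal (\<integral>A. (\<Prod>j\<in>A. w j) / F \<partial>C)"
  proof (rule nn_integral_eq_integral)
    show "AE A in C. 0 \<le> (\<Prod>j\<in>A. w j) / F"
      using w_pos partition_function_pos
      by (intro AE_I2 divide_nonneg_pos prod_nonneg) (auto intro: less_imp_le)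
  qed (simp add: integrable_prod_w)
  also have "\<dots> = 1"
    using partition_function_pos partition_function_eq by simp
  finally show "emeasure (boltzmann q z) (space (boltzmann q z)) = 1" .
qed

text \<open>Deleting the factor of index \<open>j\<close> from the product divides the partition function by
  \<open>1 + w j\<close>, which is the probability that part \<open>j\<close> is absent.\<close>

lemma nn_integral_part_present:
  "(\<integral>\<^sup>+A. ennreal ((\<Prod>i\<in>A. w i) / F) * indicator {A. j \<in> A} A \<partial>C) = ennreal (p j)"
proof -
  \<comment> \<open>Zeroing the weight at \<open>j\<close> kills exactly the products over sets
    containing \<open>j\<close>, so subtracting the two products isolates those sets.\<close>
  define w' where "w' = w(j := 0)"
  have w'_nonneg: "w' i \<ge> 0" for i
    using w_pos[of i] by (simp add: w'_def)
  have sw': "summable (\<lambda>i. norm (w' i))"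
    by (rule summable_comparison_test'[OF summable_w]) (auto simp: w'_def w_pos less_imp_le)
  have split: "(\<Prod>i\<in>A. w i) * indicator {A. j \<in> A} A = (\<Prod>i\<in>A. w i) - (\<Prod>i\<in>A. w' i)"
    if "finite A" for A
  proof (cases "j \<in> A")
    case True
    then have "(\<Prod>i\<in>A. w' i) = 0"
      using that by (auto simp: w'_def prod_zero_iff)
    then show ?thesis using True by simp
  next
    case False
    then have "(\<Prod>i\<in>A. w' i) = (\<Prod>i\<in>A. w i)"
      by (intro prod.cong) (auto simp: w'_def)
    then show ?thesis using False by simp
  qed
  let ?I = "\<integral>A. (\<Prod>i\<in>A. w' i) \<partial>C"
  have "(\<lambda>n. (1 + w j) * (\<Prod>i<n. 1 + w' i)) \<longlonglongrightarrow> (1 + w j) * ?I"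
    by (intro tendsto_mult_left prod_tendsto_integral_finite_subsets sw')
  moreover have "\<forall>\<^sub>F n in sequentially. (1 + w j) * (\<Prod>i<n. 1 + w' i) = (\<Prod>i<n. 1 + w i)"
    using eventually_gt_at_top[of j]
  proof eventually_elim
    case (elim n)
    have "(\<Prod>i<n. 1 + w i) = (1 + w j) * (\<Prod>i\<in>{..<n} - {j}. 1 + w i)"
      using elim by (intro prod.remove) auto
    also have "(\<Prod>i\<in>{..<n} - {j}. 1 + w i) = (\<Prod>i\<in>{..<n} - {j}. 1 + w' i)"
      by (intro prod.cong) (auto simp: w'_def)
    also have "\<dots> = (\<Prod>i<n. 1 + w' i)"
      using elim prod.remove[of "{..<n}" j "\<lambda>i. 1 + w' i"] by (simp add: w'_def)
    finally show ?case ..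
  qed
  ultimately have "(\<lambda>n. \<Prod>i<n. 1 + w i) \<longlonglongrightarrow> (1 + w j) * ?I"
    by (rule Lim_transform_eventually)
  then have F: "F = (1 + w j) * ?I"
    using prod_tendsto_partition_function LIMSEQ_unique by blast
  have "(\<integral>\<^sup>+A. ennreal ((\<Prod>i\<in>A. w i) / F) * indicator {A. j \<in> A} A \<partial>C) =
      (\<integral>\<^sup>+A. ennreal (((\<Prod>i\<in>A. w i) - (\<Prod>i\<in>A. w' i)) / F) \<partial>C)"
  proof (rule nn_integral_cong)
    fix A assume "A \<in> space C"
    then show "ennreal ((\<Prod>i\<in>A. w i) / F) * indicator {A. j \<in> A} A =
        ennreal (((\<Prod>i\<in>A. w i) - (\<Prod>i\<in>A. w' i)) / F)"
      by (simp add: split[symmetric] indicator_def)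
  qed
  also have "\<dots> = ennreal (\<integral>A. ((\<Prod>i\<in>A. w i) - (\<Prod>i\<in>A. w' i)) / F \<partial>C)"
  proof (rule nn_integral_eq_integral)
    show "integrable C (\<lambda>A. ((\<Prod>i\<in>A. w i) - (\<Prod>i\<in>A. w' i)) / F)"
      by (intro integrable_divide Bochner_Integration.integrable_diff integrable_prod_w
          integrable_prod_finite_subsets sw')
    show "AE A in C. 0 \<le> ((\<Prod>i\<in>A. w i) - (\<Prod>i\<in>A. w' i)) / F"
    proof (rule AE_I2)
      fix A assume "A \<in> space C"
      have "(\<Prod>i\<in>A. w' i) \<le> (\<Prod>i\<in>A. w i)"
        using w'_nonneg w_pos by (intro prod_mono) (auto simp: w'_def less_imp_le)
      then show "0 \<le> ((\<Prod>i\<in>A. w i) - (\<Prod>i\<in>A. w' i)) / F"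
        using partition_function_pos by simp
    qed
  qed
  also have "(\<integral>A. ((\<Prod>i\<in>A. w i) - (\<Prod>i\<in>A. w' i)) / F \<partial>C) = (F - ?I) / F"
    using Bochner_Integration.integral_diff[OF integrable_prod_w integrable_prod_finite_subsets[OF sw']]
    by (simp add: partition_function_eq)
  also have "\<dots> = p j"
  proof -
    have "?I = F / (1 + w j)" using F w_pos[of j] by (simp add: field_simps)
    then show ?thesis
      using partition_function_pos w_pos[of j] by (simp add: part_prob_def field_simps)
  qed
  finally show ?thesis .
qed

text \<open>An additive statistic is a nonnegative series of occupation indicators, so expectation
  and summation may be exchanged. This turns the calibration equations into equations for
  series.\<close>

lemma expectation_additive_sums:
  fixes f :: "nat \<Rightarrow> real"
  assumes f: "\<And>j. f j \<ge> 0" and X: "\<And>A. finite A \<Longrightarrow> X (partition_of q A) = (\<Sum>j\<in>A. f j)"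
    and m: "(\<integral>xs. X xs \<partial>boltzmann q z) = m" "m > 0"
  shows "(\<lambda>j. f j * p j) sums m"
proof -
  have X_nonneg: "AE xs in boltzmann q z. 0 \<le> X xs"
  proof (rule AE_I2)
    fix xs assume "xs \<in> space (boltzmann q z)"
    then have "xs \<in> partition_of q ` {A. finite A}"
      using bij_betw_partition_of[OF q] by (simp add: boltzmann_density bij_betw_def)
    then show "0 \<le> X xs" using X f by (auto simp: sum_nonneg)
  qed
  \<comment> \<open>A non-integrable function has Bochner integral 0 by convention, so the positive
    value \<open>m\<close> forces integrability.\<close>
  have "integrable (boltzmann q z) X"
    using m not_integrable_integral_eq[of "boltzmann q z" X] by linarith
  then have "ennreal m = (\<integral>\<^sup>+xs. ennreal (X xs) \<partial>boltzmann q z)"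
    using nn_integral_eq_integral[OF _ X_nonneg] m by simp
  also have "\<dots> = (\<integral>\<^sup>+A. ennreal ((\<Prod>j\<in>A. w j) / F) * ennreal (X (partition_of q A)) \<partial>C)"
    by (rule nn_integral_boltzmann)
  also have "\<dots> = (\<integral>\<^sup>+A. (\<Sum>j. ennreal (f j) * (ennreal ((\<Prod>i\<in>A. w i) / F) * indicator {A. j \<in> A} A)) \<partial>C)"
  proof (rule nn_integral_cong)
    fix A :: "nat set" assume "A \<in> space C"
    then have A: "finite A" by simp
    have "ennreal (X (partition_of q A)) = (\<Sum>j\<in>A. ennreal (f j))"
      using f by (simp add: X[OF A] sum_ennreal)
    also have "\<dots> = (\<Sum>j\<in>A. ennreal (f j) * indicator {A. j \<in> A} A)"
      by (intro sum.cong) auto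
    also have "\<dots> = (\<Sum>j. ennreal (f j) * indicator {A. j \<in> A} A)"
      by (rule suminf_finite[symmetric]) (auto simp: A)
    finally show "ennreal ((\<Prod>j\<in>A. w j) / F) * ennreal (X (partition_of q A)) =
        (\<Sum>j. ennreal (f j) * (ennreal ((\<Prod>i\<in>A. w i) / F) * indicator {A. j \<in> A} A))"
      by (simp only: ennreal_suminf_cmult[symmetric] mult.left_commute)
  qed
  also have "\<dots> = (\<Sum>j. ennreal (f j) * ennreal (p j))"
    by (subst nn_integral_suminf) (simp_all add: nn_integral_cmult nn_integral_part_present)
  also have "\<dots> = (\<Sum>j. ennreal (f j * p j))"
    using f by (simp add: ennreal_mult')
  finally have "(\<lambda>j. ennreal (f j * p j)) sums ennreal m"
    using summable_sums[OF summableI, of "\<lambda>j. ennreal (f j * p j)"] by simp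
  then show ?thesis
    using f p_pos m by (subst (asm) sums_ennreal) (auto simp: less_imp_le)
qed

text \<open>Twisting each weight \<open>w j\<close> by the unit number
  \<open>cis (s * real (Suc j ^ q) + t)\<close> keeps the product formula valid. Dividing by the
  partition function factor by factor turns \<open>(1 + w j * u j) / (1 + w j)\<close> into
  \<open>1 + p j * (u j - 1)\<close>.\<close>

lemma char_boltzmann:
  "(\<lambda>n. \<Prod>j<n. 1 + of_real (p j) * (cis (s * real (Suc j ^ q) + t) - 1))
    \<longlonglongrightarrow> (\<integral>xs. cis (s * weight xs + t * len xs) \<partial>boltzmann q z)"
proof -
  define u where "u j = cis (s * real (Suc j ^ q) + t)" for j
  have prod_u: "(\<Prod>j\<in>A. of_real (w j) * u j) =
      of_real (\<Prod>j\<in>A. w j) * cis (s * weight (partition_of q A) + t * len (partition_of q A))"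
    if "finite A" for A
  proof -
    have "cis (s * weight (partition_of q A) + t * len (partition_of q A)) =
        cis (\<Sum>j\<in>A. s * real (Suc j ^ q) + t)"
      using that by (simp add: weight_def len_def sum_list_partition_of[OF q]
          length_partition_of[OF q] sum.distrib sum_distrib_left mult.commute)
    also have "\<dots> = (\<Prod>j\<in>A. u j)"
      using that by (induction A rule: finite_induct) (auto simp: u_def cis_mult[symmetric])
    finally show ?thesis by (simp add: prod.distrib)
  qed
  have "summable (\<lambda>j. norm (of_real (w j) * u j))"
    using summable_w w_pos by (simp add: norm_mult u_def abs_of_pos)
  then have "(\<lambda>n. \<Prod>j<n. 1 + of_real (w j) * u j) \<longlonglongrightarrow> (\<integral>A. (\<Prod>j\<in>A. of_real (w j) * u j) \<partial>C)"
    by (rule prod_tendsto_integral_finite_subsets)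
  then have "(\<lambda>n. (\<Prod>j<n. 1 + of_real (w j) * u j) / of_real (\<Prod>j<n. 1 + w j))
      \<longlonglongrightarrow> (\<integral>A. (\<Prod>j\<in>A. of_real (w j) * u j) \<partial>C) / of_real F"
    using partition_function_pos
    by (intro tendsto_divide tendsto_of_real prod_tendsto_partition_function) auto
  moreover have "(\<Prod>j<n. 1 + of_real (w j) * u j) / of_real (\<Prod>j<n. 1 + w j) =
      (\<Prod>j<n. 1 + of_real (p j) * (u j - 1))" for n
  proof -
    have "(1 + of_real (w j) * u j) / of_real (1 + w j) = 1 + of_real (p j) * (u j - 1)" for j
    proof -
      have "complex_of_real (1 + w j) \<noteq> 0" using w_pos[of j] by (simp del: of_real_add)
      then show ?thesis by (simp add: part_prob_def field_simps)
    qed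
    then show ?thesis by (simp flip: prod_dividef)
  qed
  moreover have "(\<integral>A. (\<Prod>j\<in>A. of_real (w j) * u j) \<partial>C) / of_real F =
      (\<integral>xs. cis (s * weight xs + t * len xs) \<partial>boltzmann q z)"
  proof -
    have "(\<integral>xs. cis (s * weight xs + t * len xs) \<partial>boltzmann q z) =
        (\<integral>A. (\<Prod>j\<in>A. of_real (w j) * u j) / of_real F \<partial>C)"
      unfolding integral_boltzmann
      by (intro Bochner_Integration.integral_cong) (simp_all add: prod_u scaleR_conv_of_real)
    then show ?thesis by simp
  qed
  ultimately show ?thesis by (simp add: u_def)
qed

end

lemma calibrated_sums:
  assumes "q \<ge> 1" "calibrated q N M z" "N > 0" "M > 0"
  shows "(\<lambda>j. real (Suc j ^ q) * part_prob q z j) sums N" "part_prob q z sums M"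
proof -
  interpret boltzmann_params q z
    using assms by unfold_locales (auto simp: calibrated_def)
  show "(\<lambda>j. real (Suc j ^ q) * p j) sums N"
    using assms by (intro expectation_additive_sums[of _ weight])
      (auto simp: calibrated_def weight_def sum_list_partition_of[OF q])
  have "(\<lambda>j. 1 * p j) sums M"
    using assms by (intro expectation_additive_sums[of _ len])
      (auto simp: calibrated_def len_def length_partition_of[OF q])
  then show "p sums M" by simp
qed

section \<open>Riemann sums\<close>

text \<open>Rounding \<open>x\<close> up to the grid of mesh \<open>h\<close> is constant on each
  interval \<open>{h * j<..h * (j + 1)}\<close>, so a right-endpoint Riemann sum is the integral of
  a step function.\<close>

lemma nn_integral_ceiling_sum:
  fixes g :: "real \<Rightarrow> real" and h :: real
  assumes h: "h > 0" and [measurable]: "g \<in> borel_measurable borel" and nn: "\<And>x. x > 0 \<Longrightarrow> g x \<ge> 0"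
  shows "(\<integral>\<^sup>+x. ennreal (g (h * \<lceil>x / h\<rceil>) * indicator {0<..} x) \<partial>lborel) = (\<Sum>j. ennreal (h * g (h * real (Suc j))))"
proof -
  let ?S = "\<lambda>j. {h * real j<..h * real (Suc j)}"
  have mem: "x \<in> ?S j \<longleftrightarrow> \<lceil>x / h\<rceil> = int (Suc j)" for x j
  proof -
    have "\<lceil>x / h\<rceil> = int (Suc j) \<longleftrightarrow> real j < x / h \<and> x / h \<le> real (Suc j)"
      by (simp add: ceiling_eq_iff)
    then show ?thesis using h by (auto simp: field_simps)
  qed
  have pt: "ennreal (g (h * \<lceil>x / h\<rceil>) * indicator {0<..} x) =
      (\<Sum>j. ennreal (g (h * real (Suc j))) * indicator (?S j) x)" for x
  proof (cases "x > 0")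
    case True
    then have "\<lceil>x / h\<rceil> \<ge> 1" using h by (simp add: le_ceiling_iff)
    then have "\<lceil>x / h\<rceil> = int (Suc (nat (\<lceil>x / h\<rceil> - 1)))" by simp
    then obtain i where i: "\<lceil>x / h\<rceil> = int (Suc i)" ..
    have "(\<Sum>j. ennreal (g (h * real (Suc j))) * indicator (?S j) x) =
        (\<Sum>j\<in>{i}. ennreal (g (h * real (Suc j))) * indicator (?S j) x)"
    proof (rule suminf_finite)
      fix j assume "j \<notin> {i}"
      then have "x \<notin> ?S j" using mem[of x j] i by simp
      then show "ennreal (g (h * real (Suc j))) * indicator (?S j) x = 0"
        by (simp add: indicator_def del: of_nat_Suc greaterThanAtMost_iff)
    qed simp
    also have "\<dots> = ennreal (g (h * real (Suc i)))"
      using i mem[of x i] by (simp add: indicator_def)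
    finally show ?thesis
      using True i by simp
  next
    case False
    then have "x \<notin> ?S j" for j
      using h by (auto simp: not_less intro: order_trans)
    then show ?thesis using False by simp
  qed
  have "(\<integral>\<^sup>+x. ennreal (g (h * \<lceil>x / h\<rceil>) * indicator {0<..} x) \<partial>lborel) =
      (\<Sum>j. \<integral>\<^sup>+x. ennreal (g (h * real (Suc j))) * indicator (?S j) x \<partial>lborel)"
    unfolding pt by (rule nn_integral_suminf) measurable
  also have "\<dots> = (\<Sum>j. ennreal (h * g (h * real (Suc j))))"
  proof (rule suminf_cong)
    fix j
    have "(\<integral>\<^sup>+x. ennreal (g (h * real (Suc j))) * indicator (?S j) x \<partial>lborel) =
        ennreal (g (h * real (Suc j))) * ennreal (h * real (Suc j) - h * real j)"
      using h by (subst nn_integral_cmult_indicator) auto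
    also have "h * real (Suc j) - h * real j = h"
      by (simp add: algebra_simps)
    finally show "(\<integral>\<^sup>+x. ennreal (g (h * real (Suc j))) * indicator (?S j) x \<partial>lborel) =
        ennreal (h * g (h * real (Suc j)))"
      using h nn[of "h * real (Suc j)"] by (simp add: ennreal_mult' mult.commute)
  qed
  finally show ?thesis .
qed

section \<open>Moments of the limiting profile and convergence of the Riemann sums\<close>

definition moment_fun :: "nat \<Rightarrow> nat \<Rightarrow> real \<Rightarrow> real" where
  "moment_fun q k x = x ^ (k * q) * exp (- (x ^ q))"

text \<open>For \<open>q \<ge> 1\<close> the substitution \<open>t = x ^ q\<close> identifies this
  with \<open>Gamma (k + 1 / q) / q\<close>; the argument works with positivity and the recursion in
  \<open>k\<close>.\<close>

definition moment :: "nat \<Rightarrow> nat \<Rightarrow> real" where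
  "moment q k = (\<integral>x. moment_fun q k x * indicator {0<..} x \<partial>lborel)"

lemma borel_measurable_moment_fun [measurable]: "moment_fun q k \<in> borel_measurable borel"
  unfolding moment_fun_def by measurable

lemma isCont_moment_fun: "isCont (moment_fun q k) x"
proof -
  have "isCont (\<lambda>x. x ^ (k * q) * exp (- (x ^ q))) x" by (intro continuous_intros)
  then show ?thesis by (simp add: moment_fun_def[abs_def])
qed

lemma moment_fun_nonneg: "x \<ge> 0 \<Longrightarrow> moment_fun q k x \<ge> 0"
  by (simp add: moment_fun_def)

text \<open>An integrable function dominating all Riemann step functions of mesh at most 1.\<close>

definition moment_bound :: "nat \<Rightarrow> nat \<Rightarrow> real \<Rightarrow> real" where
  "moment_bound q k x = 2 ^ (k * q) * exp 1 * (exp (- x) + x ^ (k * q) * exp (- x))"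

text \<open>The power is bounded through \<open>y \<le> 2 * max 1 x\<close>, the exponential through
  \<open>y ^ q \<ge> x - 1\<close>, which is trivial for \<open>x < 1\<close> and follows from
  \<open>y ^ q \<ge> y\<close> otherwise.\<close>

lemma moment_fun_le_bound:
  assumes q: "q \<ge> 1" and x: "0 \<le> x" "x \<le> y" "y \<le> x + 1"
  shows "moment_fun q k y \<le> moment_bound q k x"
proof -
  have "y ^ (k * q) \<le> (2 * max 1 x) ^ (k * q)"
    using x by (intro power_mono) auto
  also have "\<dots> \<le> 2 ^ (k * q) * (1 + x ^ (k * q))"
    using x by (auto simp: power_mult_distrib max_def intro: mult_left_mono)
  finally have 1: "y ^ (k * q) \<le> 2 ^ (k * q) * (1 + x ^ (k * q))" .
  have "x - 1 \<le> y ^ q"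
  proof (cases "x \<ge> 1")
    case True
    then have "y ^ 1 \<le> y ^ q" using x q by (intro power_increasing) auto
    then show ?thesis using x by simp
  next
    case False
    have "0 \<le> y ^ q" using x by simp
    then show ?thesis using False by linarith
  qed
  then have 2: "exp (- (y ^ q)) \<le> exp 1 * exp (- x)"
    by (simp flip: exp_add)
  have "moment_fun q k y \<le> (2 ^ (k * q) * (1 + x ^ (k * q))) * (exp 1 * exp (- x))"
    unfolding moment_fun_def using 1 2 x by (intro mult_mono) auto
  then show ?thesis
    by (simp add: moment_bound_def algebra_simps)
qed

lemma integrable_moment_bound: "integrable lborel (\<lambda>x. moment_bound q k x * indicator {0<..} x)"
proof -
  have int: "integrable lborel (\<lambda>x. (x ^ m * exp (- x)) * indicator {0..} x :: real)" for m
  proof (rule integrableI_nonneg)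
    have "(\<integral>\<^sup>+x. ennreal ((x ^ m * exp (- x)) * indicator {0..} x) \<partial>lborel) =
        (\<integral>\<^sup>+x. ennreal (x ^ m * exp (- x)) * indicator {0..} x \<partial>lborel)"
      by (intro nn_integral_cong) (simp add: indicator_def)
    also have "\<dots> < \<infinity>"
      by (subst nn_intergal_power_times_exp_Ici) simp
    finally show "(\<integral>\<^sup>+x. ennreal ((x ^ m * exp (- x)) * indicator {0..} x) \<partial>lborel) < \<infinity>" .
  qed (auto simp: indicator_def)
  have "integrable lborel (\<lambda>x. 2 ^ (k * q) * exp 1 * ((x ^ 0 * exp (- x)) * indicator {0..} x
      + (x ^ (k * q) * exp (- x)) * indicator {0..} x) :: real)"
    using int[of 0] int[of "k * q"] by (intro integrable_mult_right Bochner_Integration.integrable_add)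
  then show ?thesis
    by (rule Bochner_Integration.integrable_bound)
      (auto simp: moment_bound_def indicator_def abs_mult)
qed

lemma moment_bound_nonneg: "x \<ge> 0 \<Longrightarrow> moment_bound q k x \<ge> 0"
  by (simp add: moment_bound_def)

lemma integrable_moment_fun:
  assumes "q \<ge> 1"
  shows "integrable lborel (\<lambda>x. moment_fun q k x * indicator {0<..} x)"
  by (rule Bochner_Integration.integrable_bound[OF integrable_moment_bound[of q k]])
    (use assms moment_fun_le_bound[of q] in \<open>auto simp: indicator_def moment_fun_nonneg moment_bound_nonneg\<close>)

definition riemann_sum :: "nat \<Rightarrow> nat \<Rightarrow> real \<Rightarrow> real" where
  "riemann_sum q k h = (\<Sum>j. h * moment_fun q k (h * real (Suc j)))"

lemma ceiling_step:
  fixes x h :: real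
  assumes "h > 0"
  shows "x \<le> h * \<lceil>x / h\<rceil> \<and> h * \<lceil>x / h\<rceil> < x + h"
proof -
  have "h * (x / h) \<le> h * \<lceil>x / h\<rceil>" "h * \<lceil>x / h\<rceil> < h * (x / h + 1)"
    using assms ceiling_correct[of "x / h"] by (intro mult_left_mono mult_strict_left_mono; simp)+
  then show ?thesis
    using assms by (simp add: distrib_left)
qed

lemma riemann_sum_step:
  assumes q: "q \<ge> 1" and h: "0 < h" "h \<le> 1"
  shows "(\<lambda>j. h * moment_fun q k (h * real (Suc j))) sums
      (\<integral>x. moment_fun q k (h * \<lceil>x / h\<rceil>) * indicator {0<..} x \<partial>lborel)" (is "_ sums ?I")
proof -
  have int: "integrable lborel (\<lambda>x. moment_fun q k (h * \<lceil>x / h\<rceil>) * indicator {0<..} x)"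
  proof (rule Bochner_Integration.integrable_bound[OF integrable_moment_bound[of q k]])
    show "AE x in lborel. norm (moment_fun q k (h * \<lceil>x / h\<rceil>) * indicator {0<..} x)
        \<le> norm (moment_bound q k x * indicator {0<..} x)"
    proof (rule AE_I2)
      fix x :: real
      show "norm (moment_fun q k (h * \<lceil>x / h\<rceil>) * indicator {0<..} x)
        \<le> norm (moment_bound q k x * indicator {0<..} x)"
        using ceiling_step[OF h(1), of x] h moment_fun_le_bound[OF q, of x "h * \<lceil>x / h\<rceil>" k]
        by (auto simp: indicator_def moment_fun_nonneg moment_bound_nonneg)
    qed
  qed simp
  have nn: "0 \<le> moment_fun q k (h * \<lceil>x / h\<rceil>) * indicator {0<..} x" for x
    using ceiling_step[OF h(1), of x] by (auto simp: indicator_def intro!: moment_fun_nonneg)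
  have "ennreal ?I = (\<integral>\<^sup>+x. ennreal (moment_fun q k (h * \<lceil>x / h\<rceil>) * indicator {0<..} x) \<partial>lborel)"
    using int nn by (intro nn_integral_eq_integral[symmetric]) auto
  also have "\<dots> = (\<Sum>j. ennreal (h * moment_fun q k (h * real (Suc j))))"
    by (rule nn_integral_ceiling_sum[where g="moment_fun q k", OF h(1)]) (auto simp: moment_fun_nonneg)
  finally have "(\<lambda>j. ennreal (h * moment_fun q k (h * real (Suc j)))) sums ennreal ?I"
    using summable_sums[OF summableI, of "\<lambda>j. ennreal (h * moment_fun q k (h * real (Suc j)))"] by simp
  moreover have "?I \<ge> 0" using nn by (intro Bochner_Integration.integral_nonneg) auto
  ultimately show ?thesis
    using h by (subst (asm) sums_ennreal) (auto simp: moment_fun_nonneg)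
qed

text \<open>The step functions converge pointwise by continuity, since rounding moves
  \<open>x\<close> by less than \<open>h n\<close>. Once the mesh is at most 1 they are dominated by
  \<open>moment_bound\<close>, hence the shift by \<open>n0\<close>.\<close>

lemma riemann_sum_tendsto:
  assumes q: "q \<ge> 1" and h: "\<And>n. h n > 0" "h \<longlonglongrightarrow> 0"
  shows "(\<lambda>n. riemann_sum q k (h n)) \<longlonglongrightarrow> moment q k"
proof -
  have ev: "\<forall>\<^sub>F n in sequentially. h n \<le> 1"
    using order_tendstoD(2)[OF h(2), of 1] by (auto elim: eventually_mono)
  then obtain n0 where n0: "\<And>n. n \<ge> n0 \<Longrightarrow> h n \<le> 1"
    unfolding eventually_sequentially by blast
  let ?f = "\<lambda>n x. moment_fun q k (h n * \<lceil>x / h n\<rceil>) * indicator {0<..} x"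
  have "(\<lambda>n. \<integral>x. ?f (n + n0) x \<partial>lborel) \<longlonglongrightarrow> moment q k"
    unfolding moment_def
  proof (rule integral_dominated_convergence[OF _ _ integrable_moment_bound[of q k]])
    show "AE x in lborel. (\<lambda>n. ?f (n + n0) x) \<longlonglongrightarrow> moment_fun q k x * indicator {0<..} x"
    proof (rule AE_I2)
      fix x :: real
      have "(\<lambda>n. h n * \<lceil>x / h n\<rceil>) \<longlonglongrightarrow> x"
      proof (rule tendsto_sandwich[of "\<lambda>_. x" _ _ "\<lambda>n. x + h n"])
        show "(\<lambda>n. x + h n) \<longlonglongrightarrow> x" using tendsto_add[OF tendsto_const[of x] h(2)] by simp
      qed (use ceiling_step[OF h(1)] in \<open>auto intro!: always_eventually less_imp_le\<close>)
      then have "(\<lambda>n. h (n + n0) * \<lceil>x / h (n + n0)\<rceil>) \<longlonglongrightarrow> x"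
        by (rule LIMSEQ_ignore_initial_segment)
      then show "(\<lambda>n. ?f (n + n0) x) \<longlonglongrightarrow> moment_fun q k x * indicator {0<..} x"
        by (intro tendsto_mult tendsto_const isCont_tendsto_compose[OF isCont_moment_fun])
    qed
    show "AE x in lborel. norm (?f (n + n0) x) \<le> moment_bound q k x * indicator {0<..} x" for n
    proof (rule AE_I2)
      fix x :: real
      show "norm (?f (n + n0) x) \<le> moment_bound q k x * indicator {0<..} x"
        using ceiling_step[OF h(1), of x "n + n0"] n0[of "n + n0"]
          moment_fun_le_bound[OF q, of x "h (n + n0) * \<lceil>x / h (n + n0)\<rceil>" k]
        by (auto simp: indicator_def moment_fun_nonneg moment_bound_nonneg)
    qed
  qed simp_all
  moreover have "(\<integral>x. ?f (n + n0) x \<partial>lborel) = riemann_sum q k (h (n + n0))" for n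
    using riemann_sum_step[OF q h(1) n0, of "n + n0" k] unfolding riemann_sum_def by (simp add: sums_iff)
  ultimately show ?thesis
    by (simp add: LIMSEQ_offset)
qed

text \<open>For \<open>k = 0\<close> the profile is decreasing on the positive axis, so
  right-endpoint sums stay below the integral at every mesh \<open>h > 0\<close>.\<close>

lemma riemann_sum_0_le:
  assumes q: "q \<ge> 1" and h: "h > 0"
  shows "summable (\<lambda>j. exp (- ((h * real (Suc j)) ^ q)))"
    and "(\<Sum>j. exp (- ((h * real (Suc j)) ^ q))) \<le> moment q 0 / h"
proof -
  have "(\<Sum>j. ennreal (h * moment_fun q 0 (h * real (Suc j)))) =
      (\<integral>\<^sup>+x. ennreal (moment_fun q 0 (h * \<lceil>x / h\<rceil>) * indicator {0<..} x) \<partial>lborel)"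
    by (rule nn_integral_ceiling_sum[where g="moment_fun q 0", OF h, symmetric])
      (auto simp: moment_fun_nonneg)
  also have "\<dots> \<le> (\<integral>\<^sup>+x. ennreal (moment_fun q 0 x * indicator {0<..} x) \<partial>lborel)"
    using ceiling_step[OF h]
    by (intro nn_integral_mono ennreal_leI) (auto simp: indicator_def moment_fun_def intro: power_mono)
  also have "\<dots> = ennreal (moment q 0)"
    unfolding moment_def using integrable_moment_fun[OF q]
    by (intro nn_integral_eq_integral) (auto simp: indicator_def moment_fun_nonneg)
  finally have le: "(\<Sum>j. ennreal (h * exp (- ((h * real (Suc j)) ^ q)))) \<le> ennreal (moment q 0)"
    by (simp add: moment_fun_def)
  then have "summable (\<lambda>j. h * exp (- ((h * real (Suc j)) ^ q)))"
    using h by (intro summable_suminf_not_top) (auto simp: top_unique)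
  then show s: "summable (\<lambda>j. exp (- ((h * real (Suc j)) ^ q)))"
    using h by (simp add: summable_mult_D)
  have "ennreal (h * (\<Sum>j. exp (- ((h * real (Suc j)) ^ q)))) \<le> ennreal (moment q 0)"
    using le h s by (subst (asm) suminf_ennreal_eq) (auto intro!: sums_mult summable_sums)
  moreover have "moment q 0 \<ge> 0"
    unfolding moment_def by (intro Bochner_Integration.integral_nonneg) (auto simp: indicator_def moment_fun_nonneg)
  ultimately show "(\<Sum>j. exp (- ((h * real (Suc j)) ^ q))) \<le> moment q 0 / h"
    using h by (simp add: field_simps)
qed

lemma moment_0_pos:
  assumes q: "q \<ge> 1"
  shows "moment q 0 > 0"
proof -
  have "exp (- 1 :: real) = (\<integral>x. exp (- 1) * indicator {0<..1::real} x \<partial>lborel)"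
    by simp
  also have "\<dots> \<le> moment q 0"
    unfolding moment_def
  proof (rule integral_mono[OF _ integrable_moment_fun[OF q]])
    show "integrable lborel (\<lambda>x. exp (- 1 :: real) * indicator {0<..1::real} x)"
      by (intro integrable_mult_right integrable_real_indicator) simp_all
    show "exp (- 1) * indicator {0<..1} x \<le> moment_fun q 0 x * indicator {0<..} x" for x :: real
      by (auto simp: indicator_def moment_fun_def power_le_one)
  qed
  finally show ?thesis
    using exp_gt_zero[of "-1 :: real"] by linarith
qed

text \<open>Integration by parts, in the form that the derivative of \<open>x\<^bsup>kq+1\<^esup> exp (-x\<^bsup>q\<^esup>)\<close> has integral zero.\<close>

lemma moment_Suc:
  assumes q: "q \<ge> 1"
  shows "real q * moment q (Suc k) = real (k * q + 1) * moment q k"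
proof -
  let ?m = "k * q"
  let ?f = "\<lambda>x. real (?m + 1) * moment_fun q k x - real q * moment_fun q (Suc k) x"
  let ?F = "\<lambda>x::real. x ^ (?m + 1) * exp (- (x ^ q))"
  have deriv: "DERIV ?F x :> ?f x" for x
  proof -
    have "((\<lambda>x. x ^ m * exp (- (x ^ q))) has_real_derivative
        real m * x ^ (m - 1) * exp (- (x ^ q)) - real q * (x ^ m * x ^ (q - 1)) * exp (- (x ^ q))) (at x)" for m
      by (auto intro!: derivative_eq_intros)
    from this[of "?m + 1"] have "DERIV ?F x :>
        real (?m + 1) * x ^ ?m * exp (- (x ^ q)) - real q * x ^ (?m + 1 + (q - 1)) * exp (- (x ^ q))"
      by (simp only: power_add[symmetric] add_diff_cancel_right')
    moreover have "?m + 1 + (q - 1) = Suc k * q" using q by simp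
    ultimately show ?thesis
      by (simp only: moment_fun_def mult.assoc)
  qed
  have cont: "isCont ?f x" for x
    by (intro continuous_intros isCont_moment_fun)
  have int: "integrable lborel (\<lambda>x. ?f x * indicator {0<..} x)"
    using integrable_moment_fun[OF q, of k] integrable_moment_fun[OF q, of "Suc k"]
    by (simp add: left_diff_distrib mult.assoc)
  have "(\<lambda>n. \<integral>x. ?f x * indicator {0..real n} x \<partial>lborel) \<longlonglongrightarrow> (\<integral>x. ?f x * indicator {0<..} x \<partial>lborel)"
  proof (rule integral_dominated_convergence[where w="\<lambda>x. norm (?f x * indicator {0<..} x)"])
    \<comment> \<open>The integral over \<open>{0..real n}\<close> suits the fundamental theorem,
      the moments use the open half-line; the two differ at the null point 0.\<close>
    show "AE x in lborel. (\<lambda>n. ?f x * indicator {0..real n} x) \<longlonglongrightarrow> ?f x * indicator {0<..} x"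
      using AE_lborel_singleton[of "0::real"]
    proof eventually_elim
      case (elim x)
      have "\<forall>\<^sub>F n in sequentially. ?f x * indicator {0..real n} x = ?f x * indicator {0<..} x"
        using eventually_ge_at_top[of "nat \<lceil>x\<rceil>"]
        by eventually_elim (use elim in \<open>auto simp: indicator_def nat_le_iff ceiling_le_iff\<close>)
      then show ?case by (rule tendsto_eventually)
    qed
    show "AE x in lborel. norm (?f x * indicator {0..real n} x) \<le> norm (?f x * indicator {0<..} x)" for n
      using AE_lborel_singleton[of "0::real"] by eventually_elim (auto simp: indicator_def)
  qed (use int in \<open>auto intro: integrable_norm\<close>)
  moreover have "(\<integral>x. ?f x * indicator {0..real n} x \<partial>lborel) = ?F (real n)" for n
    by (subst integral_FTC_Icc_real[where F="?F"]) (use deriv cont in auto)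
  moreover have "(\<lambda>n. ?F (real n)) \<longlonglongrightarrow> 0"
  proof (rule tendsto_sandwich[of "\<lambda>_. 0" _ _ "\<lambda>n. real n ^ (?m + 1) / exp (real n)"])
    show "\<forall>\<^sub>F n in sequentially. ?F (real n) \<le> real n ^ (?m + 1) / exp (real n)"
      using eventually_ge_at_top[of "1::nat"]
    proof eventually_elim
      case (elim n)
      then have "real n ^ 1 \<le> real n ^ q" using q by (intro power_increasing) auto
      then show ?case by (simp add: exp_minus divide_inverse[symmetric] frac_le)
    qed
    show "(\<lambda>n. real n ^ (?m + 1) / exp (real n)) \<longlonglongrightarrow> 0"
      using filterlim_compose[OF tendsto_power_div_exp_0 filterlim_real_sequentially] .
  qed auto
  ultimately have "(\<integral>x. ?f x * indicator {0<..} x \<partial>lborel) = 0"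
    using LIMSEQ_unique by simp
  moreover have "(\<integral>x. ?f x * indicator {0<..} x \<partial>lborel) = real (?m + 1) * moment q k - real q * moment q (Suc k)"
    unfolding moment_def
    using integrable_moment_fun[OF q, of k] integrable_moment_fun[OF q, of "Suc k"]
    by (simp add: left_diff_distrib mult.assoc)
  ultimately show ?thesis by simp
qed

section \<open>Power sums of the occupation probabilities\<close>

lemma power_superadditive:
  fixes x y :: real
  assumes "x \<ge> 0" "y \<ge> 0" "q \<ge> 1"
  shows "x ^ q + y ^ q \<le> (x + y) ^ q"
  using assms(3)
proof (induction q rule: dec_induct)
  case (step q)
  have "x ^ Suc q + y ^ Suc q \<le> (x + y) * (x ^ q + y ^ q)"
    using assms by (simp add: algebra_simps)
  also have "\<dots> \<le> (x + y) * (x + y) ^ q"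
    using step assms by (intro mult_left_mono) auto
  finally show ?case by simp
qed simp

lemma power_sum_le:
  fixes x y :: real
  assumes "x \<ge> 0" "y \<ge> 0"
  shows "(x + y) ^ q \<le> 2 ^ q * (x ^ q + y ^ q)"
proof -
  have "(x + y) ^ q \<le> (2 * max x y) ^ q"
    using assms by (intro power_mono) auto
  also have "\<dots> \<le> 2 ^ q * (x ^ q + y ^ q)"
    using assms by (auto simp: power_mult_distrib max_def)
  finally show ?thesis .
qed

text \<open>The quadratic Taylor bound gives \<open>t \<le> exp (t / 2)\<close>; a linear factor is
  thus absorbed by half of the exponent.\<close>

lemma mult_exp_minus_le:
  fixes t :: real
  assumes "t \<ge> 0"
  shows "t * exp (- t) \<le> exp (- (t / 2))"
proof -
  have "t \<le> 1 + t / 2 + (t / 2)\<^sup>2 / 2"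
    using zero_le_power2[of "t - 2"] by (simp add: power2_eq_square field_simps)
  also have "\<dots> \<le> exp (t / 2)"
    using assms by (intro exp_lower_Taylor_quadratic) simp
  finally have "t * exp (- t) \<le> exp (t / 2) * exp (- t)"
    by (intro mult_right_mono) auto
  then show ?thesis by (simp flip: exp_add)
qed

text \<open>The constant in the bound \<open>N \<le> K M\<^bsup>q+1\<^esup>\<close> valid when \<open>z\<^sub>2 \<ge> e\<close>.\<close>

definition weight_const :: "nat \<Rightarrow> real \<Rightarrow> real" where
  "weight_const q e = (1 + 2 ^ q * (e / 2) * (2 + 4 * 2 ^ q) * moment q 0) * ((1 + e / 2) / (e / 2) + 1) ^ (q + 1)"

section \<open>Bounds for the mean weight and the power sums\<close>

context boltzmann_params
begin

text \<open>The mesh at which the weights sample the profile: \<open>w j\<close> is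
  \<open>snd z\<close> times \<open>exp (- (x ^ q))\<close> at
  \<open>x = h * (j + 1)\<close>.\<close>

definition "h = root q (- ln (fst z))"

lemma h_pos: "h > 0"
  using z q by (simp add: h_def)

lemma w_eq: "w j = snd z * exp (- ((h * real (Suc j)) ^ q))"
proof -
  have "h ^ q = - ln (fst z)"
    using z q by (simp add: h_def)
  then have "fst z = exp (- (h ^ q))"
    using z by simp
  then show ?thesis
    by (simp add: part_weight_def power_mult_distrib exp_of_nat_mult[symmetric] mult.commute
        del: of_nat_Suc flip: of_nat_power)
qed

lemma w_antimono: "i \<le> j \<Longrightarrow> w j \<le> w i"
  using z q h_pos unfolding w_eq by (auto intro!: mult_left_mono power_mono)

lemma p_antimono: "i \<le> j \<Longrightarrow> p j \<le> p i"
  using w_antimono[of i j] w_pos[of i] w_pos[of j] by (simp add: part_prob_def field_simps)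

text \<open>Replacing \<open>p\<close> by the larger \<open>w\<close> makes the series a multiple of
  a Riemann sum, which lies below its integral.\<close>

lemma h_mult_le:
  assumes "p sums M"
  shows "h * M \<le> snd z * moment q 0"
proof -
  note R = riemann_sum_0_le[OF q h_pos]
  have "M \<le> (\<Sum>j. w j)"
    using assms summable_w p_le_w by (metis sums_iff suminf_le)
  also have "\<dots> = snd z * (\<Sum>j. exp (- ((h * real (Suc j)) ^ q)))"
    unfolding w_eq by (rule suminf_mult[OF R(1)])
  also have "\<dots> \<le> snd z * (moment q 0 / h)"
    using R(2) z by (intro mult_left_mono) auto
  finally show ?thesis
    using h_pos by (simp add: field_simps)
qed

text \<open>By monotonicity of \<open>p\<close>, \<open>p j \<le> d\<close> as soon as \<open>j + 1 \<ge> n\<close> for some \<open>n\<close> of order \<open>M\<close>; beyond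
  this index the weights decay like \<open>exp (- (h i)\<^sup>q)\<close>, and \<open>z\<^sub>2 \<ge> e\<close> makes \<open>1 / h\<close> at most \<open>2 n\<close>.\<close>

lemma weight_le_len_power:
  assumes M: "p sums M" and N: "(\<lambda>j. real (Suc j ^ q) * p j) sums N"
    and "M \<ge> 1" and e: "0 < e" "e \<le> snd z"
  shows "N \<le> weight_const q e * M ^ (q + 1)"
proof -
  \<comment> \<open>The value of the occupation probability at weight \<open>e / 2\<close>; as
    \<open>t / (1 + t)\<close> increases, \<open>p j \<le> d\<close> is equivalent to
    \<open>w j \<le> e / 2\<close>.\<close>
  define d where "d = (e / 2) / (1 + e / 2)"
  have d: "0 < d" "d < 1" using e by (auto simp: d_def)
  \<comment> \<open>Chosen so that \<open>n * p (n - 1) \<le> M \<le> n * d\<close>. Index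
    \<open>n - 1\<close> stands for the part \<open>n ^ q\<close>.\<close>
  define n where "n = nat \<lceil>M / d\<rceil>"
  have "M \<le> M / d" using d \<open>M \<ge> 1\<close> by (simp add: le_divide_eq mult_left_le)
  moreover have n_ge: "M / d \<le> real n"
    unfolding n_def by linarith
  ultimately have n_M: "M \<le> real n" by linarith
  then have n1: "n \<ge> 1" using \<open>M \<ge> 1\<close> by linarith
  have "real n \<le> M / d + 1"
    using \<open>M \<ge> 1\<close> d unfolding n_def by (simp add: of_nat_ceiling)
  also have "\<dots> \<le> (1 / d + 1) * M"
    using \<open>M \<ge> 1\<close> by (simp add: algebra_simps)
  finally have n_le: "real n \<le> (1 / d + 1) * M" .
  have partial: "(\<Sum>j<n. p j) \<le> M"
    using M p_pos by (metis sums_iff sum_le_suminf finite_lessThan less_imp_le)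
  have "real n * p (n - 1) \<le> (\<Sum>j<n. p j)"
    using sum_mono[of "{..<n}" "\<lambda>_. p (n - 1)" p] p_antimono by simp
  then have "real n * p (n - 1) \<le> real n * d"
    using partial n_ge d by (simp add: field_simps)
  then have "p (n - 1) \<le> d" using n1 by simp
  then have w_n: "w (n - 1) \<le> e / 2"
    using e w_pos[of "n - 1"] by (simp add: part_prob_def d_def field_simps)
  \<comment> \<open>If \<open>h * n\<close> were below 1/2, the weight at index \<open>n - 1\<close>
    would exceed \<open>snd z / 2 \<ge> e / 2\<close>.\<close>
  have hn_half: "1 / 2 \<le> h * real n"
  proof (rule ccontr)
    assume "\<not> 1 / 2 \<le> h * real n"
    then have lt: "h * real n < 1 / 2" by simp
    have "(h * real n) ^ q \<le> (h * real n) ^ 1"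
      using h_pos lt q by (intro power_decreasing) auto
    then have "1 / 2 < 1 - (h * real n) ^ q" using lt by simp
    also have "\<dots> \<le> exp (- ((h * real n) ^ q))"
      using exp_ge_add_one_self[of "- ((h * real n) ^ q)"] by simp
    finally have "snd z * (1 / 2) < w (n - 1)"
      unfolding w_eq using n1 z by simp
    then show False using w_n e by simp
  qed
  then have h_inv: "1 / h \<le> 2 * real n"
    using h_pos by (simp add: field_simps)
  let ?E = "\<lambda>h i. exp (- ((h * real (Suc i)) ^ q))"
  \<comment> \<open>Superadditivity of the power splits the factor
    \<open>w (n - 1) \<le> e / 2\<close> off the weight at \<open>i + n\<close>, while the power of
    \<open>n + (i + 1)\<close> is shared between its two summands.\<close>
  have tail: "real (Suc (i + n) ^ q) * p (i + n) \<le>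
      2 ^ q * (e / 2) * (real n ^ q * ?E h i + (1 / h) ^ q * ?E (h / 2) i)" for i
  proof -
    define t where "t = (h * real (Suc i)) ^ q"
    have t: "t \<ge> 0" using h_pos by (simp add: t_def)
    have split: "real (Suc (i + n)) = real n + real (Suc i)" by simp
    have "real (Suc (i + n) ^ q) \<le> 2 ^ q * (real n ^ q + real (Suc i) ^ q)"
      unfolding of_nat_power split by (rule power_sum_le) auto
    moreover have "p (i + n) \<le> e / 2 * exp (- t)"
    proof -
      have "(h * real n) ^ q + t \<le> (h * real (Suc (i + n))) ^ q"
        unfolding split distrib_left t_def using h_pos q by (intro power_superadditive) auto
      then have "w (i + n) \<le> snd z * exp (- ((h * real n) ^ q) - t)"
        unfolding w_eq using z by (intro mult_left_mono) auto
      also have "\<dots> = w (n - 1) * exp (- t)"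
        unfolding w_eq using n1 by (simp add: exp_add[symmetric])
      also have "\<dots> \<le> e / 2 * exp (- t)"
        using w_n by (intro mult_right_mono) auto
      finally show ?thesis using p_le_w[of "i + n"] by linarith
    qed
    ultimately have "real (Suc (i + n) ^ q) * p (i + n) \<le>
        (2 ^ q * (real n ^ q + real (Suc i) ^ q)) * (e / 2 * exp (- t))"
      using p_pos[of "i + n"] by (intro mult_mono) auto
    also have "\<dots> = 2 ^ q * (e / 2) * (real n ^ q * exp (- t) + real (Suc i) ^ q * exp (- t))"
      by (simp add: algebra_simps)
    also have "\<dots> \<le> 2 ^ q * (e / 2) * (real n ^ q * exp (- t) + (1 / h) ^ q * ?E (h / 2) i)"
    proof -
      \<comment> \<open>The growing factor is \<open>t / h ^ q\<close>; absorbing \<open>t\<close>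
        halves the exponent, and \<open>t / 2 \<ge> t / 2 ^ q\<close> rewrites the result as a
        sample at mesh \<open>h / 2\<close>.\<close>
      have "real (Suc i) ^ q * exp (- t) = (1 / h) ^ q * (t * exp (- t))"
        using h_pos by (simp add: t_def power_mult_distrib power_divide)
      also have "\<dots> \<le> (1 / h) ^ q * exp (- (t / 2))"
        using mult_exp_minus_le[OF t] h_pos by (intro mult_left_mono) auto
      also have "\<dots> \<le> (1 / h) ^ q * ?E (h / 2) i"
      proof -
        have "(2::real) ^ 1 \<le> 2 ^ q" using q by (intro power_increasing) auto
        then have "t / 2 ^ q \<le> t / 2" using t by (intro divide_left_mono) auto
        then have "(h / 2 * real (Suc i)) ^ q \<le> t / 2"
          by (simp add: t_def power_mult_distrib power_divide)
        then show ?thesis using h_pos by (intro mult_left_mono) auto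
      qed
      finally show ?thesis using e by (intro mult_left_mono add_left_mono) auto
    qed
    finally show ?thesis by (simp only: t_def)
  qed
  note R1 = riemann_sum_0_le[OF q h_pos]
  have h2: "h / 2 > 0" using h_pos by simp
  note R2 = riemann_sum_0_le[OF q h2]
  have sN: "summable (\<lambda>j. real (Suc j ^ q) * p j)" using N by (rule sums_summable)
  have "N = (\<Sum>i. real (Suc (i + n) ^ q) * p (i + n)) + (\<Sum>j<n. real (Suc j ^ q) * p j)"
    using suminf_split_initial_segment[OF sN, of n] N by (simp add: sums_iff)
  also have "(\<Sum>i. real (Suc (i + n) ^ q) * p (i + n)) \<le>
      (\<Sum>i. 2 ^ q * (e / 2) * (real n ^ q * ?E h i + (1 / h) ^ q * ?E (h / 2) i))"
    using tail summable_ignore_initial_segment[OF sN, of n] R1(1) R2(1)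
    by (intro suminf_le summable_mult summable_add) auto
  also have "\<dots> = 2 ^ q * (e / 2) * (real n ^ q * (\<Sum>i. ?E h i) + (1 / h) ^ q * (\<Sum>i. ?E (h / 2) i))"
    using R1(1) R2(1) by (subst suminf_mult) (auto simp: suminf_add[symmetric] suminf_mult
        intro!: summable_mult summable_add)
  also have "\<dots> \<le> 2 ^ q * (e / 2) * (real n ^ q * (moment q 0 * (2 * real n))
      + (2 * real n) ^ q * (2 * moment q 0 * (2 * real n)))"
  proof -
    have m0: "moment q 0 \<ge> 0" using moment_0_pos[OF q] by simp
    have "(\<Sum>i. ?E h i) \<le> moment q 0 * (2 * real n)"
      using R1(2) mult_left_mono[OF h_inv m0] by simp
    moreover have "moment q 0 / (h / 2) = 2 * (moment q 0 * (1 / h))" by simp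
    moreover from this have "(\<Sum>i. ?E (h / 2) i) \<le> 2 * moment q 0 * (2 * real n)"
      using R2(2) mult_left_mono[OF h_inv m0] by linarith
    moreover have "(1 / h) ^ q \<le> (2 * real n) ^ q"
      using h_inv h_pos by (intro power_mono) auto
    moreover have "(\<Sum>i. ?E (h / 2) i) \<ge> 0"
      using R2(1) by (intro suminf_nonneg) auto
    ultimately show ?thesis
      using e by (intro mult_left_mono add_mono mult_mono) auto
  qed
  also have "(\<Sum>j<n. real (Suc j ^ q) * p j) \<le> real n ^ q * real n"
  proof -
    have "(\<Sum>j<n. real (Suc j ^ q) * p j) \<le> (\<Sum>j<n. real n ^ q * p j)"
      using p_pos by (intro sum_mono mult_right_mono) (auto simp: less_imp_le simp del: of_nat_Suc intro!: power_mono)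
    also have "\<dots> \<le> real n ^ q * real n"
      unfolding sum_distrib_left[symmetric] using partial n_M by (intro mult_left_mono) auto
    finally show ?thesis .
  qed
  \<comment> \<open>The summand 1 comes from the indices below \<open>n\<close>, the 2 from the tail
    sum at mesh \<open>h\<close>, and \<open>4 * 2 ^ q\<close> from the one at mesh
    \<open>h / 2\<close>, using \<open>1 / h \<le> 2 * n\<close> throughout.\<close>
  finally have "N \<le> (1 + 2 ^ q * (e / 2) * (2 + 4 * 2 ^ q) * moment q 0) * real n ^ (q + 1)"
    by (simp add: algebra_simps power_mult_distrib)
  also have "\<dots> \<le> (1 + 2 ^ q * (e / 2) * (2 + 4 * 2 ^ q) * moment q 0) * ((1 / d + 1) * M) ^ (q + 1)"
    using n_le e moment_0_pos[OF q] by (intro mult_left_mono power_mono) auto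
  also have "\<dots> = weight_const q e * M ^ (q + 1)"
    by (simp add: weight_const_def d_def power_mult_distrib)
  finally show ?thesis .
qed

definition "power_sum k = (\<Sum>j. real (Suc j ^ q) ^ k * p j)"

text \<open>With \<open>w\<close> in place of \<open>p\<close>, the rescaled power sum is exactly
  the Riemann sum; termwise \<open>(1 - snd z) * w j \<le> p j \<le> w j\<close> gives both
  sides.\<close>

lemma power_sum_bounds:
  assumes h1: "h \<le> 1"
  shows "summable (\<lambda>j. real (Suc j ^ q) ^ k * p j)"
    and "power_sum k * h ^ (k * q + 1) / snd z \<le> riemann_sum q k h"
    and "(1 - snd z) * riemann_sum q k h \<le> power_sum k * h ^ (k * q + 1) / snd z"
proof -
  define c where "c = h ^ (k * q + 1) / snd z"
  have c: "c > 0" using h_pos z by (simp add: c_def)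
  have summand: "h * moment_fun q k (h * real (Suc j)) = c * (real (Suc j ^ q) ^ k * w j)" for j
  proof -
    have "real (Suc j ^ q) ^ k = real (Suc j) ^ (k * q)"
      by (simp add: power_mult[symmetric] mult.commute del: of_nat_Suc)
    then show ?thesis
      using z by (simp add: c_def moment_fun_def w_eq power_mult_distrib del: of_nat_Suc)
  qed
  have R: "(\<lambda>j. c * (real (Suc j ^ q) ^ k * w j)) sums riemann_sum q k h"
    using riemann_sum_step[OF q h_pos h1, of k] unfolding riemann_sum_def summand by (simp add: sums_iff)
  then have sw: "summable (\<lambda>j. real (Suc j ^ q) ^ k * w j)"
    using c by (simp add: sums_iff summable_cmult_iff)
  have le: "real (Suc j ^ q) ^ k * p j \<le> real (Suc j ^ q) ^ k * w j" for j
    by (intro mult_left_mono p_le_w) simp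
  show s: "summable (\<lambda>j. real (Suc j ^ q) ^ k * p j)"
    by (rule summable_comparison_test'[OF sw, of 0]) (use le p_pos in \<open>auto simp: abs_mult less_imp_le\<close>)
  have P: "(\<lambda>j. c * (real (Suc j ^ q) ^ k * p j)) sums (power_sum k * h ^ (k * q + 1) / snd z)"
    using sums_mult[OF summable_sums[OF s], of c] by (simp add: c_def power_sum_def mult.commute)
  show "power_sum k * h ^ (k * q + 1) / snd z \<le> riemann_sum q k h"
    by (rule sums_le[OF _ P R]) (use le c in \<open>simp add: mult_left_mono\<close>)
  have Q: "(\<lambda>j. (1 - snd z) * (c * (real (Suc j ^ q) ^ k * w j))) sums ((1 - snd z) * riemann_sum q k h)"
    by (rule sums_mult[OF R])
  have "(1 - snd z) * (c * (real (Suc j ^ q) ^ k * w j)) \<le> c * (real (Suc j ^ q) ^ k * p j)" for j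
  proof -
    have "c * real (Suc j ^ q) ^ k * (w j * (1 - snd z)) \<le> c * real (Suc j ^ q) ^ k * p j"
      using c by (intro mult_left_mono p_ge) simp
    then show ?thesis by (simp add: mult_ac)
  qed
  then show "(1 - snd z) * riemann_sum q k h \<le> power_sum k * h ^ (k * q + 1) / snd z"
    by (rule sums_le[OF _ Q P])
qed

end

section \<open>Asymptotic normality\<close>

text \<open>Mean value inequality on the convex left half-plane, where the derivative of
  \<open>exp\<close> has modulus at most 1.\<close>

lemma norm_exp_diff_le:
  fixes x y :: complex
  assumes "Re x \<le> 0" "Re y \<le> 0"
  shows "norm (exp x - exp y) \<le> norm (x - y)"
proof -
  have "norm (exp x - exp y) \<le> 1 * norm (x - y)"
  proof (rule field_differentiable_bound[where f'=exp and S="{z. Re z \<le> 0}"])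
    show "(exp has_field_derivative exp z) (at z within {z. Re z \<le> 0})" for z :: complex
      by (rule DERIV_exp[THEN has_field_derivative_at_within])
  qed (use assms convex_halfspace_Re_le in auto)
  then show ?thesis by simp
qed

text \<open>Mean value inequality for \<open>exp z - z\<close> on the half-plane cut by a ball of
  radius \<open>norm x\<close>: there the derivative \<open>exp z - 1\<close> is at most
  \<open>norm x\<close> in modulus.\<close>

lemma norm_exp_minus_linear_le:
  fixes x :: complex
  assumes "Re x \<le> 0"
  shows "norm (exp x - (1 + x)) \<le> (norm x)\<^sup>2"
proof -
  let ?S = "{z. Re z \<le> 0} \<inter> cball 0 (norm x)"
  have "norm ((exp x - x) - (exp 0 - 0)) \<le> norm x * norm (x - 0)"
  proof (rule field_differentiable_bound[where f'="\<lambda>z. exp z - 1" and S="?S"])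
    show "convex ?S" by (intro convex_Int convex_halfspace_Re_le convex_cball)
    show "((\<lambda>z. exp z - z) has_field_derivative exp z - 1) (at z within ?S)" for z
      by (auto intro!: derivative_eq_intros)
    show "norm (exp z - 1) \<le> norm x" if "z \<in> ?S" for z
      using norm_exp_diff_le[of z 0] that by auto
  qed (use assms in auto)
  then show ?thesis by (simp add: power2_eq_square algebra_simps)
qed

lemma norm_cis_minus_1_le: "norm (cis a - 1) \<le> \<bar>a\<bar>"
  using iexp_approx1[of a 0] by (simp add: cis_conv_exp)

text \<open>The comparison passes through a Poisson variable. Replacing \<open>1 + w\<close> by
  \<open>exp w\<close> costs \<open>(norm w)\<^sup>2\<close>, which gives the first error; after
  centring, the exponent differs from \<open>- p * a\<^sup>2 / 2\<close> by \<open>p\<close> times a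
  third-order Taylor remainder, which gives the second.\<close>

lemma bernoulli_char_approx:
  assumes p: "0 \<le> p" "p \<le> 1"
  shows "norm ((1 + of_real p * (cis a - 1)) * cis (- (p * a)) - of_real (exp (- (p * a\<^sup>2) / 2)))
    \<le> p\<^sup>2 * a\<^sup>2 + p * \<bar>a\<bar> ^ 3 / 6"
proof -
  define w where "w = of_real p * (cis a - 1)"
  define v where "v = w + - \<i> * of_real (p * a)"
  have Re_w: "Re w \<le> 0" using p by (simp add: w_def mult_le_0_iff)
  have Re_v: "Re v \<le> 0" using Re_w by (simp add: v_def)
  have "norm w \<le> p * \<bar>a\<bar>"
    unfolding w_def norm_mult using p norm_cis_minus_1_le by (simp add: mult_left_mono)
  then have w2: "(norm w)\<^sup>2 \<le> p\<^sup>2 * a\<^sup>2"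
    using power_mono[of "norm w" "p * \<bar>a\<bar>" 2] by (simp add: power_mult_distrib)
  have exp_v: "exp v = exp w * cis (- (p * a))"
    unfolding v_def exp_add by (simp add: cis_conv_exp)
  have "norm ((1 + w) * cis (- (p * a)) - exp v) = norm (exp w - (1 + w))"
    unfolding exp_v left_diff_distrib[symmetric] norm_mult by (simp add: norm_minus_commute)
  then have 1: "norm ((1 + w) * cis (- (p * a)) - exp v) \<le> p\<^sup>2 * a\<^sup>2"
    using norm_exp_minus_linear_le[OF Re_w] w2 by linarith
  have "of_real (exp (- (p * a\<^sup>2) / 2)) = exp (of_real (- (p * a\<^sup>2) / 2) :: complex)"
    by (rule exp_of_real[symmetric])
  moreover have "norm (exp v - exp (of_real (- (p * a\<^sup>2) / 2))) \<le> norm (v - of_real (- (p * a\<^sup>2) / 2))"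
    using Re_v p by (intro norm_exp_diff_le) auto
  moreover have "v - of_real (- (p * a\<^sup>2) / 2) = of_real p * (cis a - (\<Sum>k\<le>2. (\<i> * of_real a) ^ k / fact k))"
    by (simp add: v_def w_def numeral_2_eq_2 algebra_simps power2_eq_square)
  moreover have "norm (of_real p * (cis a - (\<Sum>k\<le>2. (\<i> * of_real a) ^ k / fact k))) \<le> p * (\<bar>a\<bar> ^ 3 / 6)"
  proof -
    have "norm (cis a - (\<Sum>k\<le>2. (\<i> * of_real a) ^ k / fact k)) \<le> \<bar>a\<bar> ^ 3 / 6"
      using iexp_approx1[of a 2] by (simp add: cis_conv_exp numeral_3_eq_3 fact_numeral)
    from mult_left_mono[OF this p(1)] show ?thesis
      using p by (simp add: norm_mult)
  qed
  ultimately have 2: "norm (exp v - of_real (exp (- (p * a\<^sup>2) / 2))) \<le> p * \<bar>a\<bar> ^ 3 / 6"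
    by simp
  show ?thesis
    using norm_triangle_le[of "(1 + w) * cis (- (p * a)) - exp v" "exp v - of_real (exp (- (p * a\<^sup>2) / 2))", OF add_mono[OF 1 2]]
    by (simp add: w_def)
qed

text \<open>Products of numbers of modulus at most 1 differ by at most the sum of the differences of
  their factors. The uniform bound \<open>r\<close> turns \<open>(p j)\<^sup>2\<close> into
  \<open>r * p j\<close>, and the estimate survives the limit of the partial products.\<close>

lemma bernoulli_sum_char_approx:
  fixes p a :: "nat \<Rightarrow> real"
  assumes p: "\<And>j. 0 \<le> p j" "\<And>j. p j \<le> 1" "\<And>j. p j \<le> r"
    and m: "(\<lambda>j. p j * a j) sums m" and Q: "(\<lambda>j. p j * (a j)\<^sup>2) sums Q"
    and R: "(\<lambda>j. p j * \<bar>a j\<bar> ^ 3) sums R"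
    and \<Phi>: "(\<lambda>n. \<Prod>j<n. 1 + of_real (p j) * (cis (a j) - 1)) \<longlonglongrightarrow> \<Phi>"
  shows "norm (\<Phi> * cis (- m) - of_real (exp (- Q / 2))) \<le> r * Q + R / 6"
proof -
  let ?x = "\<lambda>j. (1 + of_real (p j) * (cis (a j) - 1)) * cis (- (p j * a j))"
  let ?y = "\<lambda>j. complex_of_real (exp (- (p j * (a j)\<^sup>2) / 2))"
  have bound: "norm ((\<Prod>j<n. ?x j) - (\<Prod>j<n. ?y j)) \<le> r * Q + R / 6" for n
  proof -
    have nx: "norm (?x j) \<le> 1" for j
    proof -
      have "1 + of_real (p j) * (cis (a j) - 1) = of_real (1 - p j) + of_real (p j) * cis (a j)"
        by (simp add: algebra_simps)
      also have "norm \<dots> \<le> norm (of_real (1 - p j) :: complex) + norm (of_real (p j) * cis (a j))"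
        by (rule norm_triangle_ineq)
      also have "\<dots> = 1"
        unfolding norm_mult norm_of_real using p(1,2)[of j] by simp
      finally show ?thesis by (simp add: norm_mult)
    qed
    have ny: "norm (?y j) \<le> 1" for j
      using p(1)[of j] by simp
    have "norm ((\<Prod>j<n. ?x j) - (\<Prod>j<n. ?y j)) \<le> (\<Sum>j<n. norm (?x j - ?y j))"
      using nx ny by (intro norm_prod_diff)
    also have "\<dots> \<le> (\<Sum>j<n. r * (p j * (a j)\<^sup>2) + p j * \<bar>a j\<bar> ^ 3 / 6)"
    proof (rule sum_mono)
      fix j
      have "(p j)\<^sup>2 * (a j)\<^sup>2 \<le> r * (p j * (a j)\<^sup>2)"
        using mult_right_mono[OF p(3)[of j], of "p j * (a j)\<^sup>2"] p(1)[of j]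
        by (simp add: power2_eq_square[of "p j"] mult.assoc)
      then show "norm (?x j - ?y j) \<le> r * (p j * (a j)\<^sup>2) + p j * \<bar>a j\<bar> ^ 3 / 6"
        using bernoulli_char_approx[OF p(1,2), of j "a j"] by linarith
    qed
    also have "\<dots> = r * (\<Sum>j<n. p j * (a j)\<^sup>2) + (\<Sum>j<n. p j * \<bar>a j\<bar> ^ 3) / 6"
      by (simp add: sum.distrib sum_distrib_left sum_divide_distrib)
    also have "\<dots> \<le> r * Q + R / 6"
    proof -
      have "0 \<le> r" using p(1,3)[of 0] by linarith
      moreover have "(\<Sum>j<n. p j * (a j)\<^sup>2) \<le> Q" "(\<Sum>j<n. p j * \<bar>a j\<bar> ^ 3) \<le> R"
        using Q R p(1) unfolding sums_iff by (auto intro!: sum_le_suminf)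
      ultimately show ?thesis by (intro add_mono mult_left_mono divide_right_mono) auto
    qed
    finally show ?thesis .
  qed
  have cis_prod: "(\<Prod>j<n. cis (- (p j * a j))) = cis (- (\<Sum>j<n. p j * a j))" for n
    by (induction n) (simp_all add: cis_mult)
  have "(\<lambda>n. \<Prod>j<n. ?x j) \<longlonglongrightarrow> \<Phi> * cis (- m)"
    unfolding prod.distrib cis_prod using m
    by (intro tendsto_mult \<Phi> tendsto_cis tendsto_minus) (simp add: sums_def)
  moreover have "(\<lambda>n. \<Prod>j<n. ?y j) \<longlonglongrightarrow> of_real (exp (- Q / 2))"
  proof -
    have "(\<Prod>j<n. ?y j) = of_real (exp (- (\<Sum>j<n. p j * (a j)\<^sup>2) / 2))" for n
      by (simp only: of_real_prod[symmetric] exp_sum[OF finite_lessThan, symmetric]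
          sum_divide_distrib[symmetric] sum_negf)
    moreover have "(\<lambda>n. \<Sum>j<n. p j * (a j)\<^sup>2) \<longlonglongrightarrow> Q"
      using Q by (simp only: sums_def)
    ultimately show ?thesis
      by (simp only:) (intro tendsto_of_real tendsto_exp tendsto_divide tendsto_minus tendsto_const; simp)
  qed
  ultimately have "(\<lambda>n. norm ((\<Prod>j<n. ?x j) - (\<Prod>j<n. ?y j))) \<longlonglongrightarrow>
      norm (\<Phi> * cis (- m) - of_real (exp (- Q / 2)))"
    by (intro tendsto_norm tendsto_diff)
  then show ?thesis
    using bound by (intro LIMSEQ_le_const2) auto
qed

section \<open>Asymptotics along a calibrated sequence\<close>

locale calibrated_sequence =
  fixes q :: nat and N M :: "nat \<Rightarrow> real" and z :: "nat \<Rightarrow> real \<times> real"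
  assumes q: "q \<ge> 1"
    and N_pos: "\<And>n. N n > 0" and M_pos: "\<And>n. M n > 0"
    and M_top: "filterlim M at_top sequentially"
    and kappa: "(\<lambda>n. M n ^ (q + 1) / N n) \<longlonglongrightarrow> 0"
    and calibrated: "\<And>n. calibrated q (N n) (M n) (z n)"
begin

sublocale B: boltzmann_params q "z n" for n
  using q calibrated[of n] by unfold_locales (auto simp: calibrated_def)

abbreviation "r n \<equiv> snd (z n)"
abbreviation "h n \<equiv> boltzmann_params.h q (z n)"
abbreviation "S k n \<equiv> boltzmann_params.power_sum q (z n) k"

lemma sums_N: "(\<lambda>j. real (Suc j ^ q) * part_prob q (z n) j) sums N n"
  and sums_M: "part_prob q (z n) sums M n"
  by (rule calibrated_sums[OF q calibrated N_pos M_pos])+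

text \<open>If \<open>r n \<ge> e\<close> and \<open>M n \<ge> 1\<close>, then \<open>N n\<close> is
  at most a constant times \<open>M n ^ (q + 1)\<close>, which the decay of their ratio excludes for
  large \<open>n\<close>.\<close>

lemma r_tendsto_0: "r \<longlonglongrightarrow> 0"
proof (rule order_tendstoI)
  show "\<forall>\<^sub>F n in sequentially. r n > a" if "a < 0" for a
    using less_trans[OF that B.z(3)] by simp
  show "\<forall>\<^sub>F n in sequentially. r n < e" if "0 < e" for e
  proof -
    have "(\<lambda>n. weight_const q e * (M n ^ (q + 1) / N n)) \<longlonglongrightarrow> weight_const q e * 0"
      by (intro tendsto_mult_left kappa)
    then have "\<forall>\<^sub>F n in sequentially. weight_const q e * (M n ^ (q + 1) / N n) < 1"
      by (intro order_tendstoD) auto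
    moreover have "\<forall>\<^sub>F n in sequentially. M n \<ge> 1"
      using M_top by (simp add: filterlim_at_top)
    ultimately show ?thesis
    proof eventually_elim
      case (elim n)
      show ?case
      proof (rule ccontr)
        assume "\<not> r n < e"
        then have "N n \<le> weight_const q e * M n ^ (q + 1)"
          using B.weight_le_len_power[OF sums_M sums_N] elim that by simp
        then have "1 \<le> weight_const q e * (M n ^ (q + 1) / N n)"
          using N_pos[of n] by (simp add: field_simps)
        then show False using elim by simp
      qed
    qed
  qed
qed

lemma h_tendsto_0: "h \<longlonglongrightarrow> 0"
proof (rule tendsto_sandwich[of "\<lambda>_. 0"])
  show "(\<lambda>n. r n * moment q 0 * inverse (M n)) \<longlonglongrightarrow> 0"
    using tendsto_mult[OF tendsto_mult[OF r_tendsto_0 tendsto_const] tendsto_inverse_0_at_top[OF M_top]]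
    by simp
  have "h n \<le> r n * moment q 0 * inverse (M n)" for n
    using B.h_mult_le[OF sums_M] M_pos[of n] by (simp add: field_simps)
  then show "\<forall>\<^sub>F n in sequentially. h n \<le> r n * moment q 0 * inverse (M n)"
    by simp
  show "\<forall>\<^sub>F n in sequentially. 0 \<le> h n"
    using B.h_pos by (simp add: less_imp_le)
qed simp

lemma eventually_h_le_1: "\<forall>\<^sub>F n in sequentially. h n \<le> 1"
  using order_tendstoD(2)[OF h_tendsto_0, of 1] by (auto elim: eventually_mono)

text \<open>The power sum in the scale of its Riemann sum; in the ratios formed below all powers of
  \<open>h n\<close> and \<open>r n\<close> cancel.\<close>

definition "T k n = S k n * h n ^ (k * q + 1) / r n"

lemma T_tendsto: "T k \<longlonglongrightarrow> moment q k"
proof (rule tendsto_sandwich[OF _ _ _ riemann_sum_tendsto[OF q B.h_pos h_tendsto_0]])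
  note R = riemann_sum_tendsto[OF q B.h_pos h_tendsto_0, of k]
  show "(\<lambda>n. (1 - r n) * riemann_sum q k (h n)) \<longlonglongrightarrow> moment q k"
    using tendsto_mult[OF tendsto_diff[OF tendsto_const[of 1] r_tendsto_0] R] by simp
  show "\<forall>\<^sub>F n in sequentially. (1 - r n) * riemann_sum q k (h n) \<le> T k n"
    using eventually_h_le_1 by eventually_elim (unfold T_def, rule B.power_sum_bounds(3))
  show "\<forall>\<^sub>F n in sequentially. T k n \<le> riemann_sum q k (h n)"
    using eventually_h_le_1 by eventually_elim (unfold T_def, rule B.power_sum_bounds(2))
qed

lemma moment_pos: "moment q k > 0"
proof (induction k)
  case (Suc k)
  have "real q * moment q (Suc k) > 0"
    unfolding moment_Suc[OF q] by (rule mult_pos_pos[OF _ Suc]) (simp add: add_pos_nonneg)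
  then show ?case using q by (simp add: zero_less_mult_iff)
qed (rule moment_0_pos[OF q])

lemma S_0: "S 0 n = M n" and S_1: "S 1 n = N n"
  using sums_M[of n] sums_N[of n] by (simp_all add: B.power_sum_def sums_iff)

text \<open>The exponents of \<open>h n\<close> balance,
  \<open>1 + (2 * q + 1) = 2 * (q + 1)\<close>, so the ratio is exactly one of the
  \<open>T k n\<close>. The recursion gives \<open>moment q 1 = moment q 0 / q\<close> and
  \<open>moment q 2 = (q + 1) / q * moment q 1\<close>, hence the limit.\<close>

lemma variance_ratio: "(\<lambda>n. M n * S 2 n / (N n)\<^sup>2) \<longlonglongrightarrow> real q + 1"
proof -
  have "(\<lambda>n. T 0 n * T 2 n / (T 1 n)\<^sup>2) \<longlonglongrightarrow> moment q 0 * moment q 2 / (moment q 1)\<^sup>2"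
    using moment_pos[of 1] by (intro tendsto_intros T_tendsto) simp
  moreover have "T 0 n * T 2 n / (T 1 n)\<^sup>2 = M n * S 2 n / (N n)\<^sup>2" for n
  proof -
    define G where "G = h n ^ (2 * q + 1)"
    define H where "H = h n ^ (q + 1)"
    have GH: "G * h n = H\<^sup>2"
    proof -
      have "(q + 1) * 2 = (2 * q + 1) + 1" by simp
      then show ?thesis unfolding G_def H_def by (metis power_mult power_add power_one_right)
    qed
    have T: "T 0 n = M n * h n / r n" "T 1 n = N n * H / r n" "T 2 n = S 2 n * G / r n"
      by (simp_all only: T_def S_0 S_1 G_def H_def mult_0 mult_1 add_0 power_one_right)
    have "T 0 n * T 2 n = M n * S 2 n * (G * h n) / (r n)\<^sup>2"
      unfolding T by (simp add: power2_eq_square)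
    moreover have "(T 1 n)\<^sup>2 = (N n)\<^sup>2 * H\<^sup>2 / (r n)\<^sup>2"
      unfolding T by (simp add: power_mult_distrib power_divide)
    moreover have "H \<noteq> 0" "r n \<noteq> 0"
      using B.h_pos[of n] B.z(3)[of n] by (auto simp: H_def)
    ultimately show ?thesis
      unfolding GH by simp
  qed
  moreover have "moment q 0 * moment q 2 / (moment q 1)\<^sup>2 = real q + 1"
  proof -
    have "moment q 2 = (real q + 1) / real q * moment q 1" "moment q 1 = moment q 0 / real q"
      using moment_Suc[OF q, of 0] moment_Suc[OF q, of 1] q by (simp_all add: field_simps numeral_2_eq_2)
    moreover have "moment q 0 \<noteq> 0" using moment_pos[of 0] by simp
    ultimately show ?thesis using q by (simp add: power2_eq_square)
  qed
  ultimately show ?thesis by simp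
qed

text \<open>The quantity equals the convergent ratio
  \<open>(T 0 n)\<^sup>2 * T 3 n / (T 1 n) ^ 3\<close> times \<open>1 / sqrt (M n)\<close>.\<close>

lemma skewness_tendsto_0: "(\<lambda>n. S 3 n * (sqrt (M n) / N n) ^ 3) \<longlonglongrightarrow> 0"
proof -
  have "(\<lambda>n. (T 0 n)\<^sup>2 * T 3 n / (T 1 n) ^ 3 * inverse (sqrt (M n)))
      \<longlonglongrightarrow> (moment q 0)\<^sup>2 * moment q 3 / (moment q 1) ^ 3 * 0"
    using moment_pos[of 1]
    by (intro tendsto_intros T_tendsto tendsto_inverse_0_at_top filterlim_compose[OF sqrt_at_top M_top]) simp
  moreover have "(T 0 n)\<^sup>2 * T 3 n / (T 1 n) ^ 3 * inverse (sqrt (M n)) = S 3 n * (sqrt (M n) / N n) ^ 3" for n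
  proof -
    define G where "G = h n ^ (3 * q + 1)"
    define H where "H = h n ^ (q + 1)"
    have GH: "(h n)\<^sup>2 * G = H ^ 3"
    proof -
      have "(q + 1) * 3 = 2 + (3 * q + 1)" by simp
      then show ?thesis unfolding G_def H_def by (metis power_mult power_add)
    qed
    have T: "T 0 n = M n * h n / r n" "T 1 n = N n * H / r n" "T 3 n = S 3 n * G / r n"
      by (simp_all only: T_def S_0 S_1 G_def H_def mult_0 mult_1 add_0 power_one_right)
    have "(T 0 n)\<^sup>2 * T 3 n = (M n)\<^sup>2 * S 3 n * ((h n)\<^sup>2 * G) / r n ^ 3"
      unfolding T by (simp add: power_mult_distrib power_divide power2_eq_square power3_eq_cube)
    moreover have "(T 1 n) ^ 3 = N n ^ 3 * H ^ 3 / r n ^ 3"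
      unfolding T by (simp add: power_mult_distrib power_divide)
    moreover have "H \<noteq> 0" "r n \<noteq> 0"
      using B.h_pos[of n] B.z(3)[of n] by (auto simp: H_def)
    ultimately have ratio: "(T 0 n)\<^sup>2 * T 3 n / (T 1 n) ^ 3 = (M n)\<^sup>2 * S 3 n / N n ^ 3"
      unfolding GH by simp
    have sqrt: "(M n)\<^sup>2 * inverse (sqrt (M n)) = sqrt (M n) ^ 3"
    proof -
      have "(M n)\<^sup>2 = sqrt (M n) ^ 3 * sqrt (M n)"
        using M_pos[of n] by (simp add: power2_eq_square power3_eq_cube)
      then show ?thesis using M_pos[of n] by simp
    qed
    have "(M n)\<^sup>2 * S 3 n / N n ^ 3 * inverse (sqrt (M n)) = ((M n)\<^sup>2 * inverse (sqrt (M n))) * S 3 n / N n ^ 3"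
      by simp
    then show ?thesis unfolding ratio sqrt by (simp add: power_divide)
  qed
  ultimately show ?thesis by simp
qed

text \<open>A linear combination of the normalised variables is a centred sum of independent
  Bernoulli terms with coefficients \<open>a n j\<close>. The approximation error is
  \<open>r n * Q n\<close> plus a sixth of the cubic sum, and both vanish in the limit.\<close>

lemma joint_char_tendsto:
  "(\<lambda>n. \<integral>xs. cis (s * norm_weight q (N n) (M n) xs + t * norm_len (M n) xs) \<partial>boltzmann q (z n))
    \<longlonglongrightarrow> of_real (exp (- (s\<^sup>2 + 2 * (1 / sqrt (real q + 1)) * s * t + t\<^sup>2) / 2))"
    (is "?\<Phi> \<longlonglongrightarrow> of_real (exp (- ?Q / 2))")
proof -
  define s' where "s' n = s / sqrt (real q + 1) * (sqrt (M n) / N n)" for n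
  define t' where "t' n = t / sqrt (M n)" for n
  define a where "a n j = s' n * real (Suc j ^ q) + t' n" for n j
  define Q where "Q n = (s' n)\<^sup>2 * S 2 n + 2 * s' n * t' n * N n + (t' n)\<^sup>2 * M n" for n
  \<comment> \<open>The factor 8 is \<open>2 ^ 3\<close> from bounding the cube of a sum by the sum
    of cubes; \<open>R n\<close> only dominates the cubic sum, whose own value is \<open>R'\<close>
    below.\<close>
  define R where "R n = 8 * (\<bar>s' n\<bar> ^ 3 * S 3 n + \<bar>t' n\<bar> ^ 3 * M n)" for n
  have Q_lim: "Q \<longlonglongrightarrow> ?Q"
  proof -
    \<comment> \<open>Calibration makes the mixed and the pure \<open>t\<close> term exact for every
      \<open>n\<close>; only the \<open>s\<^sup>2\<close> term needs a limit.\<close>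
    have Q_eq: "Q n = s\<^sup>2 / (real q + 1) * (M n * S 2 n / (N n)\<^sup>2) + 2 * (1 / sqrt (real q + 1)) * s * t + t\<^sup>2" for n
    proof -
      have "(s' n)\<^sup>2 = s\<^sup>2 / (real q + 1) * (M n / (N n)\<^sup>2)"
        using M_pos[of n] by (simp add: s'_def power_mult_distrib power_divide)
      moreover have "s' n * t' n * N n = 1 / sqrt (real q + 1) * s * t"
        using M_pos[of n] N_pos[of n] by (simp add: s'_def t'_def)
      moreover have "(t' n)\<^sup>2 * M n = t\<^sup>2"
        using M_pos[of n] by (simp add: t'_def power_divide)
      ultimately show ?thesis by (simp add: Q_def)
    qed
    have "(\<lambda>n. s\<^sup>2 / (real q + 1) * (M n * S 2 n / (N n)\<^sup>2) + 2 * (1 / sqrt (real q + 1)) * s * t + t\<^sup>2)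
        \<longlonglongrightarrow> s\<^sup>2 / (real q + 1) * (real q + 1) + 2 * (1 / sqrt (real q + 1)) * s * t + t\<^sup>2"
      by (intro tendsto_intros variance_ratio)
    moreover have "s\<^sup>2 / (real q + 1) * (real q + 1) = s\<^sup>2" by simp
    ultimately show ?thesis by (simp only: Q_eq[abs_def])
  qed
  have R_lim: "R \<longlonglongrightarrow> 0"
  proof -
    have R_eq: "R n = 8 * ((\<bar>s\<bar> / sqrt (real q + 1)) ^ 3 * (S 3 n * (sqrt (M n) / N n) ^ 3) + \<bar>t\<bar> ^ 3 * inverse (sqrt (M n)))" for n
    proof -
      have "\<bar>s' n\<bar> ^ 3 = (\<bar>s\<bar> / sqrt (real q + 1)) ^ 3 * (sqrt (M n) / N n) ^ 3"
        using M_pos[of n] N_pos[of n] by (simp add: s'_def abs_mult power_mult_distrib power_divide)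
      moreover have "\<bar>t' n\<bar> ^ 3 * M n = \<bar>t\<bar> ^ 3 * inverse (sqrt (M n))"
      proof -
        have "sqrt (M n) ^ 3 = M n * sqrt (M n)"
          using M_pos[of n] by (simp add: power3_eq_cube)
        then show ?thesis
          using M_pos[of n] by (simp add: t'_def abs_mult power_divide field_simps)
      qed
      ultimately show ?thesis by (simp add: R_def)
    qed
    have "(\<lambda>n. 8 * ((\<bar>s\<bar> / sqrt (real q + 1)) ^ 3 * (S 3 n * (sqrt (M n) / N n) ^ 3) + \<bar>t\<bar> ^ 3 * inverse (sqrt (M n))))
        \<longlonglongrightarrow> 8 * ((\<bar>s\<bar> / sqrt (real q + 1)) ^ 3 * 0 + \<bar>t\<bar> ^ 3 * 0)"
      by (intro tendsto_intros skewness_tendsto_0 tendsto_inverse_0_at_top filterlim_compose[OF sqrt_at_top M_top])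
    then show ?thesis by (simp only: R_eq[abs_def]) simp
  qed
  have bound: "norm (?\<Phi> n - of_real (exp (- Q n / 2))) \<le> r n * Q n + R n / 6" if h1: "h n \<le> 1" for n
  proof -
    let ?p = "part_prob q (z n)"
    let ?v = "\<lambda>j. real (Suc j ^ q)"
    have S: "(\<lambda>j. ?v j ^ k * ?p j) sums S k n" for k
      unfolding B.power_sum_def by (intro summable_sums B.power_sum_bounds h1)
    have m: "(\<lambda>j. ?p j * a n j) sums (s' n * N n + t' n * M n)"
      using sums_add[OF sums_mult[OF sums_N[of n], of "s' n"] sums_mult[OF sums_M[of n], of "t' n"]]
      by (simp only: a_def algebra_simps)
    have Q: "(\<lambda>j. ?p j * (a n j)\<^sup>2) sums Q n"
    proof -
      have "(\<lambda>j. (s' n)\<^sup>2 * (?v j ^ 2 * ?p j) + 2 * s' n * t' n * (?v j * ?p j) + (t' n)\<^sup>2 * ?p j) sums Q n"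
        unfolding Q_def by (intro sums_add sums_mult S sums_N sums_M)
      moreover have "?p j * (a n j)\<^sup>2 =
          (s' n)\<^sup>2 * (?v j ^ 2 * ?p j) + 2 * s' n * t' n * (?v j * ?p j) + (t' n)\<^sup>2 * ?p j" for j
        unfolding a_def power2_sum by (simp only: power_mult_distrib algebra_simps)
      ultimately show ?thesis by simp
    qed
    have R0: "(\<lambda>j. 8 * (\<bar>s' n\<bar> ^ 3 * (?v j ^ 3 * ?p j) + \<bar>t' n\<bar> ^ 3 * ?p j)) sums R n"
      unfolding R_def by (intro sums_add sums_mult S sums_M)
    have le: "?p j * \<bar>a n j\<bar> ^ 3 \<le> 8 * (\<bar>s' n\<bar> ^ 3 * (?v j ^ 3 * ?p j) + \<bar>t' n\<bar> ^ 3 * ?p j)" for j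
    proof -
      have "\<bar>a n j\<bar> \<le> \<bar>s' n\<bar> * ?v j + \<bar>t' n\<bar>"
        unfolding a_def using abs_triangle_ineq[of "s' n * ?v j" "t' n"] by (simp add: abs_mult)
      then have "\<bar>a n j\<bar> ^ 3 \<le> (\<bar>s' n\<bar> * ?v j + \<bar>t' n\<bar>) ^ 3"
        by (intro power_mono) auto
      also have "\<dots> \<le> 2 ^ 3 * ((\<bar>s' n\<bar> * ?v j) ^ 3 + \<bar>t' n\<bar> ^ 3)"
        by (rule power_sum_le) auto
      finally have "?p j * \<bar>a n j\<bar> ^ 3 \<le> ?p j * (2 ^ 3 * ((\<bar>s' n\<bar> * ?v j) ^ 3 + \<bar>t' n\<bar> ^ 3))"
        using B.p_pos[of n j] by (intro mult_left_mono) auto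
      then show ?thesis by (simp add: power_mult_distrib algebra_simps)
    qed
    have "summable (\<lambda>j. ?p j * \<bar>a n j\<bar> ^ 3)"
      by (rule summable_comparison_test'[OF sums_summable[OF R0], of 0])
        (use le B.p_pos in \<open>simp add: abs_mult less_imp_le\<close>)
    then obtain R' where R': "(\<lambda>j. ?p j * \<bar>a n j\<bar> ^ 3) sums R'"
      by (auto simp: summable_def)
    have "R' \<le> R n" by (rule sums_le[OF le R' R0])
    let ?\<Psi> = "\<integral>xs. cis (s' n * weight xs + t' n * len xs) \<partial>boltzmann q (z n)"
    have "norm (?\<Psi> * cis (- (s' n * N n + t' n * M n)) - of_real (exp (- Q n / 2))) \<le> r n * Q n + R' / 6"
    proof (rule bernoulli_sum_char_approx[OF _ _ _ m Q R'])
      show "0 \<le> ?p j" "?p j \<le> 1" "?p j \<le> r n" for j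
        using B.p_pos[of n j] B.p_le_1[of n j] B.p_le_w[of n j] B.w_le[of n j] by linarith+
      show "(\<lambda>k. \<Prod>j<k. 1 + of_real (?p j) * (cis (a n j) - 1)) \<longlonglongrightarrow> ?\<Psi>"
        unfolding a_def by (rule B.char_boltzmann)
    qed
    moreover have "?\<Phi> n = ?\<Psi> * cis (- (s' n * N n + t' n * M n))"
    proof -
      have "s * norm_weight q (N n) (M n) xs + t * norm_len (M n) xs =
          (s' n * weight xs + t' n * len xs) + - (s' n * N n + t' n * M n)" for xs
      proof -
        have "s * norm_weight q (N n) (M n) xs = s' n * (weight xs - N n)"
          by (simp add: norm_weight_def s'_def)
        moreover have "t * norm_len (M n) xs = t' n * (len xs - M n)"
          by (simp add: norm_len_def t'_def)
        ultimately show ?thesis by (simp add: algebra_simps)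
      qed
      then show ?thesis
        by (simp only: cis_mult[symmetric] integral_mult_left_zero)
    qed
    ultimately show ?thesis using \<open>R' \<le> R n\<close> by simp
  qed
  have "(\<lambda>n. ?\<Phi> n - of_real (exp (- Q n / 2))) \<longlonglongrightarrow> 0"
  proof (rule Lim_null_comparison)
    show "\<forall>\<^sub>F n in sequentially. norm (?\<Phi> n - of_real (exp (- Q n / 2))) \<le> r n * Q n + R n / 6"
      using eventually_h_le_1 by eventually_elim (rule bound)
    have "(\<lambda>n. r n * Q n + R n / 6) \<longlonglongrightarrow> 0 * ?Q + 0 / 6"
      by (intro tendsto_intros r_tendsto_0 Q_lim R_lim) simp
    then show "(\<lambda>n. r n * Q n + R n / 6) \<longlonglongrightarrow> 0" by simp
  qed
  moreover have "(\<lambda>n. complex_of_real (exp (- Q n / 2))) \<longlonglongrightarrow> of_real (exp (- ?Q / 2))"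
    by (intro tendsto_intros Q_lim) simp
  ultimately have "(\<lambda>n. ?\<Phi> n - of_real (exp (- Q n / 2)) + of_real (exp (- Q n / 2)))
      \<longlonglongrightarrow> 0 + of_real (exp (- ?Q / 2))"
    by (rule tendsto_add)
  then show ?thesis by (simp only: diff_add_cancel add_0)
qed

section \<open>Convergence in distribution\<close>

lemma boltzmann_real_distribution: "real_distribution (distr (boltzmann q (z n)) borel X)"
proof -
  interpret prob_space "boltzmann q (z n)" by (rule B.prob_space_boltzmann)
  show ?thesis by (rule real_distribution_distr) (simp add: B.measurable_boltzmann)
qed

lemma char_distr_boltzmann:
  "char (distr (boltzmann q (z n)) borel X) t = (\<integral>xs. cis (t * X xs) \<partial>boltzmann q (z n))"
  unfolding char_def by (subst integral_distr) (auto simp: B.measurable_boltzmann cis_conv_exp)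

lemma weak_conv_weight:
  "weak_conv_m (\<lambda>n. distr (boltzmann q (z n)) borel (norm_weight q (N n) (M n))) std_normal_distribution"
proof (rule levy_continuity[OF boltzmann_real_distribution real_dist_normal_dist])
  show "(\<lambda>n. char (distr (boltzmann q (z n)) borel (norm_weight q (N n) (M n))) t)
      \<longlonglongrightarrow> char std_normal_distribution t" for t
    using joint_char_tendsto[of t 0] by (simp add: char_distr_boltzmann char_std_normal_distribution)
qed

lemma weak_conv_len:
  "weak_conv_m (\<lambda>n. distr (boltzmann q (z n)) borel (norm_len (M n))) std_normal_distribution"
proof (rule levy_continuity[OF boltzmann_real_distribution real_dist_normal_dist])
  show "(\<lambda>n. char (distr (boltzmann q (z n)) borel (norm_len (M n))) t)
      \<longlonglongrightarrow> char std_normal_distribution t" for t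
    using joint_char_tendsto[of 0 t] by (simp add: char_distr_boltzmann char_std_normal_distribution)
qed

text \<open>With correlation \<open>1 / sqrt (real q + 1)\<close>, the limit of the joint
  characteristic function is that of the normal law, so continuity in two dimensions
  applies.\<close>

lemma weak_conv_joint:
  "weak_conv_vec (\<lambda>n. distr (boltzmann q (z n)) borel
      (\<lambda>xs. vector [norm_weight q (N n) (M n) xs, norm_len (M n) xs] :: real ^ 2))
    (multivariate_normal 0 (limit_cov q))"
proof -
  let ?\<rho> = "1 / sqrt (real q + 1)"
  have cov: "limit_cov q = corr_matrix ?\<rho>"
    by (simp add: limit_cov_def corr_matrix_def)
  have \<rho>: "?\<rho>\<^sup>2 < 1" using q by (simp add: power_divide)
  show ?thesis
    unfolding cov
  proof (rule levy_continuity_vec)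
    show "prob_space (distr (boltzmann q (z n)) borel
        (\<lambda>xs. vector [norm_weight q (N n) (M n) xs, norm_len (M n) xs] :: real ^ 2))" for n
      by (rule prob_space.prob_space_distr[OF B.prob_space_boltzmann]) (simp add: B.measurable_boltzmann)
    show "prob_space (multivariate_normal 0 (corr_matrix ?\<rho>))"
      by (rule prob_space_multivariate_normal[OF \<rho>])
    fix u :: "real ^ 2"
    have "(\<integral>x. cis (u \<bullet> x) \<partial>distr (boltzmann q (z n)) borel
          (\<lambda>xs. vector [norm_weight q (N n) (M n) xs, norm_len (M n) xs] :: real ^ 2)) =
        (\<integral>xs. cis (u $ 1 * norm_weight q (N n) (M n) xs + u $ 2 * norm_len (M n) xs) \<partial>boltzmann q (z n))" for n
      by (subst integral_distr) (auto simp: B.measurable_boltzmann inner_vec_def sum_2)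
    then show "(\<lambda>n. \<integral>x. cis (u \<bullet> x) \<partial>distr (boltzmann q (z n)) borel
          (\<lambda>xs. vector [norm_weight q (N n) (M n) xs, norm_len (M n) xs] :: real ^ 2))
        \<longlonglongrightarrow> (\<integral>x. cis (u \<bullet> x) \<partial>multivariate_normal 0 (corr_matrix ?\<rho>))"
      using joint_char_tendsto[of "u $ 1" "u $ 2"] by (simp only: char_multivariate_normal[OF \<rho>])
  qed (simp_all add: multivariate_normal_def)
qed

end

theorem theorem5p1:
  fixes q :: nat
    and N M :: "nat \<Rightarrow> real"
    and z :: "nat \<Rightarrow> real \<times> real"
  assumes "q \<ge> 1"
    and "\<And>n. N n > 0"
    and "\<And>n. M n > 0"
    and "filterlim N at_top sequentially"
    and "filterlim M at_top sequentially"
    and "(\<lambda>n. M n ^ (q + 1) / N n) \<longlonglongrightarrow> 0"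
    and "\<forall>\<^sub>F n in sequentially. calibrated q (N n) (M n) (z n)"
  shows "weak_conv_m (\<lambda>n. distr (boltzmann q (z n)) borel (norm_weight q (N n) (M n)))
           std_normal_distribution
       \<and> weak_conv_m (\<lambda>n. distr (boltzmann q (z n)) borel (norm_len (M n)))
           std_normal_distribution
       \<and> weak_conv_vec
           (\<lambda>n. distr (boltzmann q (z n)) borel
                  (\<lambda>xs. vector [norm_weight q (N n) (M n) xs, norm_len (M n) xs] :: real ^ 2))
           (multivariate_normal 0 (limit_cov q))"
proof -
  \<comment> \<open>Calibration is only eventual, so the first \<open>n0\<close> terms are dropped
    and the limits are shifted back at the end.\<close>
  obtain n0 where n0: "\<And>n. n \<ge> n0 \<Longrightarrow> calibrated q (N n) (M n) (z n)"
    using assms(7) unfolding eventually_sequentially by blast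
  interpret calibrated_sequence q "\<lambda>n. N (n + n0)" "\<lambda>n. M (n + n0)" "\<lambda>n. z (n + n0)"
  proof unfold_locales
    show "filterlim (\<lambda>n. M (n + n0)) at_top sequentially"
      using filterlim_compose[OF assms(5) filterlim_add_const_nat_at_top] .
    show "(\<lambda>n. M (n + n0) ^ (q + 1) / N (n + n0)) \<longlonglongrightarrow> 0"
      using assms(6) by (rule LIMSEQ_ignore_initial_segment)
  qed (use assms n0 in auto)
  have offset_m: "weak_conv_m \<mu> \<nu>" if "weak_conv_m (\<lambda>n. \<mu> (n + n0)) \<nu>" for \<mu> \<nu>
    using that unfolding weak_conv_m_def weak_conv_def by (auto intro: LIMSEQ_offset[where k=n0])
  have offset_vec: "weak_conv_vec \<mu> \<nu>" if "weak_conv_vec (\<lambda>n. \<mu> (n + n0)) \<nu>"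
    for \<mu> :: "nat \<Rightarrow> (real ^ 2) measure" and \<nu>
    using that unfolding weak_conv_vec_def by (auto intro: LIMSEQ_offset[where k=n0])
  show ?thesis
    by (intro conjI; (rule offset_m | rule offset_vec))
      (rule weak_conv_weight weak_conv_len weak_conv_joint)+
qed

end
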